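(* Let $A, B \in \mathbb{P}_{m}$. Then $$F_{t}(A, B) \prec_{\log} Q_{t,z}(A, B) \quad \text{for all real } t, z \text{ with } 0 < z \leq t \leq 1.$$
   Context: $\mathbb{P}_{m}$ denotes the set of $m \times m$ complex (Hermitian) positive definite matrices. Real powers of positive definite matrices are defined by functional calculus. For $A,B\in\mathbb{P}_m$ and $t\in[0,1]$, the weighted (metric) geometric mean is $A \sharp_{t} B := A^{1/2} (A^{-1/2} B A^{-1/2})^{t} A^{1/2}$, and the new weighted spectral geometric mean is $F_{t}(A, B) := (A^{-1} \sharp_{t} B)^{1/2} A^{2-2t} (A^{-1} \sharp_{t} B)^{1/2}$. For $t\in[0,1]$ and $z>0$, $Q_{t,z}(A, B) := (A^{\frac{1-t}{2z}} B^{\frac{t}{z}} A^{\frac{1-t}{2z}})^{z}$ (the matrix version of the R\'enyi relative entropy). Log-majorization: for $X,Y\in\mathbb{P}_m$ with eigenvalues in decreasing order $\lambda_1(\cdot)\ge\cdots\ge\lambda_m(\cdot)$, $X \prec_{\log} Y$ means $\prod_{i=1}^k \lambda_i(X) \le \prod_{i=1}^k \lambda_i(Y)$ for $k=1,\dots,m-1$, with equality for $k=m$. *)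

theory Defs
  imports "Jordan_Normal_Form.Schur_Decomposition"
begin

text \<open>Matrices are those of \<open>Jordan_Normal_Form\<close>: a complex \<open>m \<times> m\<close> matrix is an element of
  \<open>carrier_mat m m\<close>, the adjoint (conjugate transpose) is \<open>mat_adjoint\<close>, and \<open>x \<bullet>c y\<close> is the
  sum of all \<open>x\<^sub>i * cnj y\<^sub>i\<close>.\<close>

definition pd_mats :: "nat \<Rightarrow> complex mat set" where
  "pd_mats m = {A \<in> carrier_mat m m. mat_adjoint A = A \<and>
     (\<forall>v \<in> carrier_vec m. v \<noteq> 0\<^sub>v m \<longrightarrow> 0 < Re ((A *\<^sub>v v) \<bullet>c v))}"

definition unitary_mat :: "nat \<Rightarrow> complex mat \<Rightarrow> bool" where
  "unitary_mat m U \<longleftrightarrow> U \<in> carrier_mat m m \<and>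
     U * mat_adjoint U = 1\<^sub>m m \<and> mat_adjoint U * U = 1\<^sub>m m"

definition unitary_diag :: "nat \<Rightarrow> complex mat \<Rightarrow> (nat \<Rightarrow> real) \<Rightarrow> complex mat" where
  "unitary_diag m U d = U * mat_diag m (\<lambda>i. complex_of_real (d i)) * mat_adjoint U"

text \<open>Functional calculus for Hermitian matrices: \<open>f (U diag(d) U*) = U diag(f d) U*\<close>.
  Lemma \<open>mat_fun_unitary_diag\<close> below shows that the result does not depend on the chosen
  diagonalization, so that the definite description is meaningful.\<close>

definition mat_fun :: "(real \<Rightarrow> real) \<Rightarrow> complex mat \<Rightarrow> complex mat" where
  "mat_fun f A = (THE X. \<exists>U d. unitary_mat (dim_row A) U \<and> A = unitary_diag (dim_row A) U d \<and>
     X = unitary_diag (dim_row A) U (\<lambda>i. f (d i)))"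

definition mat_powr :: "complex mat \<Rightarrow> real \<Rightarrow> complex mat" where
  "mat_powr A p = mat_fun (\<lambda>x. x powr p) A"

definition geom_mean :: "real \<Rightarrow> complex mat \<Rightarrow> complex mat \<Rightarrow> complex mat" where
  "geom_mean t A B =
     mat_powr A (1/2) * mat_powr (mat_powr A (-1/2) * B * mat_powr A (-1/2)) t * mat_powr A (1/2)"

text \<open>The new weighted spectral geometric mean \<open>F\<^sub>t(A, B)\<close>; the inverse of \<open>A\<close> is the power
  \<open>-1\<close> (see lemma \<open>mat_powr_minus_one\<close>).\<close>

definition F_mean :: "real \<Rightarrow> complex mat \<Rightarrow> complex mat \<Rightarrow> complex mat" where
  "F_mean t A B =
     mat_powr (geom_mean t (mat_powr A (-1)) B) (1/2) * mat_powr A (2 - 2 * t) *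
     mat_powr (geom_mean t (mat_powr A (-1)) B) (1/2)"

definition Q_mean :: "real \<Rightarrow> real \<Rightarrow> complex mat \<Rightarrow> complex mat \<Rightarrow> complex mat" where
  "Q_mean t z A B =
     mat_powr (mat_powr A ((1 - t) / (2 * z)) * mat_powr B (t / z) * mat_powr A ((1 - t) / (2 * z))) z"

text \<open>Eigenvalues with algebraic multiplicity, in decreasing order (indexed from \<open>0\<close>). Taking
  real parts is harmless because the eigenvalues of a Hermitian matrix are real.\<close>

definition eigvals_desc :: "complex mat \<Rightarrow> real list" where
  "eigvals_desc A = rev (sorted_list_of_multiset (image_mset Re (proots (char_poly A))))"

text \<open>Log-majorization is a relation on positive definite matrices, hence the membership
  conditions.\<close>

definition log_majorized :: "nat \<Rightarrow> complex mat \<Rightarrow> complex mat \<Rightarrow> bool" where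
  "log_majorized m X Y \<longleftrightarrow> X \<in> pd_mats m \<and> Y \<in> pd_mats m \<and>
     (\<forall>k\<in>{1..<m}. (\<Prod>i<k. eigvals_desc X ! i) \<le> (\<Prod>i<k. eigvals_desc Y ! i)) \<and>
     (\<Prod>i<m. eigvals_desc X ! i) = (\<Prod>i<m. eigvals_desc Y ! i)"

lemma mat_adjoint_carrier [simp]:
  "A \<in> carrier_mat n m \<Longrightarrow> mat_adjoint A \<in> carrier_mat m n"
  unfolding mat_adjoint_def by (auto simp: mat_of_rows_def)

lemma unitary_diag_carrier:
  "unitary_mat m U \<Longrightarrow> unitary_diag m U d \<in> carrier_mat m m"
  unfolding unitary_diag_def unitary_mat_def by (metis mat_adjoint_carrier mult_carrier_mat mat_diag_dim)

lemma unitary_diag_intertwine: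
  assumes U: "unitary_mat m U" and V: "unitary_mat m V"
  shows "unitary_diag m U d = unitary_diag m V e \<longleftrightarrow>
    (\<forall>i<m. \<forall>j<m. (mat_adjoint V * U) $$ (i,j) * d j = e i * (mat_adjoint V * U) $$ (i,j))"
    (is "?L \<longleftrightarrow> ?R")
proof -
  define D E where "D = mat_diag m (\<lambda>i. complex_of_real (d i))"
    and "E = mat_diag m (\<lambda>i. complex_of_real (e i))"
  define U' V' where "U' = mat_adjoint U" and "V' = mat_adjoint V"
  define W where "W = V' * U"
  have c: "U \<in> carrier_mat m m" "V \<in> carrier_mat m m" "U' \<in> carrier_mat m m"
    "V' \<in> carrier_mat m m" "D \<in> carrier_mat m m" "E \<in> carrier_mat m m" "W \<in> carrier_mat m m"
    using U V unfolding D_def E_def U'_def V'_def W_def unitary_mat_def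
    by (auto intro!: mult_carrier_mat[of _ m m _ m])
  have u: "U * U' = 1\<^sub>m m" "U' * U = 1\<^sub>m m" "V * V' = 1\<^sub>m m" "V' * V = 1\<^sub>m m"
    using U V unfolding U'_def V'_def unitary_mat_def by auto
  have "?L \<longleftrightarrow> U * D * U' = V * E * V'"
    unfolding unitary_diag_def D_def E_def U'_def V'_def ..
  also have "\<dots> \<longleftrightarrow> W * D = E * W"
  proof
    assume "U * D * U' = V * E * V'"
    then have "V' * (U * D * U') * U = V' * (V * E * V') * U" by simp
    moreover have "V' * (U * D * U') * U = W * D * (U' * U)"
      unfolding W_def using c by (simp add: assoc_mult_mat[of _ m m _ m _ m])
    moreover have "V' * (V * E * V') * U = (V' * V) * E * W"
      unfolding W_def using c by (simp add: assoc_mult_mat[of _ m m _ m _ m])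
    ultimately show "W * D = E * W" using c u by simp
  next
    assume "W * D = E * W"
    then have "V * (W * D) * U' = V * (E * W) * U'" by simp
    moreover have "V * (W * D) * U' = (V * V') * (U * D * U')"
      unfolding W_def using c by (simp add: assoc_mult_mat[of _ m m _ m _ m])
    moreover have "V * (E * W) * U' = V * E * V' * (U * U')"
      unfolding W_def using c by (simp add: assoc_mult_mat[of _ m m _ m _ m])
    ultimately show "U * D * U' = V * E * V'" using c u by simp
  qed
  also have "\<dots> \<longleftrightarrow> (\<forall>i<m. \<forall>j<m. W $$ (i,j) * d j = e i * W $$ (i,j))"
    unfolding D_def E_def mat_diag_mult_left[OF c(7)] mat_diag_mult_right[OF c(7)]
    by (subst mat_eq_iff) auto
  finally show ?thesis unfolding W_def V'_def .
qed

lemma mat_fun_unitary_diag: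
  assumes U: "unitary_mat m U"
  shows "mat_fun f (unitary_diag m U d) = unitary_diag m U (\<lambda>i. f (d i))"
proof -
  have dim: "dim_row (unitary_diag m U d) = m"
    using unitary_diag_carrier[OF U] by auto
  show ?thesis
    unfolding mat_fun_def dim
  proof (rule the_equality)
    show "\<exists>V e. unitary_mat m V \<and> unitary_diag m U d = unitary_diag m V e \<and>
        unitary_diag m U (\<lambda>i. f (d i)) = unitary_diag m V (\<lambda>i. f (e i))"
      using U by blast
  next
    fix X assume "\<exists>V e. unitary_mat m V \<and> unitary_diag m U d = unitary_diag m V e \<and>
        X = unitary_diag m V (\<lambda>i. f (e i))"
    then obtain V e where V: "unitary_mat m V" and eq: "unitary_diag m U d = unitary_diag m V e"
      and X: "X = unitary_diag m V (\<lambda>i. f (e i))" by blast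
    have "unitary_diag m U (\<lambda>i. f (d i)) = unitary_diag m V (\<lambda>i. f (e i))"
      using eq unfolding unitary_diag_intertwine[OF U V]
      by (auto simp: mult.commute) metis
    then show "X = unitary_diag m U (\<lambda>i. f (d i))" using X by simp
  qed
qed

lemma mat_powr_minus_one:
  assumes U: "unitary_mat m U" and d: "\<And>i. i < m \<Longrightarrow> d i > 0"
  shows "unitary_diag m U d * mat_powr (unitary_diag m U d) (-1) = 1\<^sub>m m"
proof -
  define D E where "D = mat_diag m (\<lambda>i. complex_of_real (d i))"
    and "E = mat_diag m (\<lambda>i. complex_of_real (d i powr (-1)))"
  define U' where "U' = mat_adjoint U"
  have c: "U \<in> carrier_mat m m" "U' \<in> carrier_mat m m" "D \<in> carrier_mat m m" "E \<in> carrier_mat m m"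
    using U unfolding D_def E_def U'_def unitary_mat_def by auto
  have u: "U * U' = 1\<^sub>m m" "U' * U = 1\<^sub>m m" using U unfolding U'_def unitary_mat_def by auto
  have DE: "D * E = 1\<^sub>m m"
    unfolding D_def E_def mat_diag_diag
    by (rule eq_matI) (auto simp: mat_diag_def powr_minus dest: d simp flip: of_real_mult)
  have "U * D * U' * (U * E * U') = U * (D * ((U' * U) * (E * U')))"
    using c by (simp add: assoc_mult_mat[of _ m m _ m _ m])
  also have "\<dots> = U * ((D * E) * U')" using c u by (simp add: assoc_mult_mat[of _ m m _ m _ m])
  also have "\<dots> = 1\<^sub>m m" using c u DE by simp
  finally show ?thesis
    unfolding mat_powr_def mat_fun_unitary_diag[OF U]
    unfolding unitary_diag_def D_def E_def U'_def .
qed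

end

theory Submission
  imports Defs
begin

text \<open>Why the theorem holds. Everything rests on one operator inequality: in every dimension,
  \<open>Q\<^sub>t\<^sub>,\<^sub>z(A,B) \<le> I\<close> implies \<open>F\<^sub>t(A,B) \<le> I\<close> in the Loewner order (lemma \<open>F_mean_le_one\<close>). Indeed
  \<open>Q\<^sub>t\<^sub>,\<^sub>z(A,B) \<le> I\<close> says that \<open>B\<close> raised to \<open>t/z\<close> is at most \<open>A\<close> raised to \<open>-(1-t)/z\<close>. Because
  \<open>z/t \<le> 1\<close>, the Loewner--Heinz inequality allows to take this power on both sides, so \<open>B\<close> is at
  most \<open>A\<close> raised to \<open>-(1-t)/t\<close>. The weighted geometric mean is monotone (Loewner--Heinz again, now
  with exponent \<open>t\<close>), and for powers of one matrix it averages the exponents; hence the mean of \<open>A\<close>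
  inverse and \<open>B\<close> is at most \<open>A\<close> raised to \<open>2t-2\<close>, which is equivalent to \<open>F\<^sub>t(A,B) \<le> I\<close>. This is
  where \<open>z \<le> t \<le> 1\<close> enters.

  Both means scale with \<open>c powr t\<close> when \<open>B\<close> is replaced by \<open>c B\<close>, so the implication compares the
  largest eigenvalues of \<open>F\<close> and \<open>Q\<close>. To reach the product of the \<open>k\<close> largest eigenvalues one
  applies it to the \<open>k\<close>-th compound matrices (matrices of \<open>k \<times> k\<close> minors, i.e. the \<open>k\<close>-th exterior
  powers). By the Cauchy--Binet formula the compound is multiplicative; it also respects adjoints and
  diagonal matrices, hence functional powers of positive definite matrices, and therefore it carries
  \<open>F\<^sub>t(A,B)\<close> and \<open>Q\<^sub>t\<^sub>,\<^sub>z(A,B)\<close> to the means of the compounds of \<open>A\<close> and \<open>B\<close>. The eigenvalues of a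
  compound are the products of eigenvalues over \<open>k\<close>-subsets, the largest being the product of the
  first \<open>k\<close>. Equality for \<open>k = m\<close> is a computation with determinants, which turn the noncommutative
  powers into powers of positive reals.

  The Loewner--Heinz inequality is proved by a midpoint argument: the exponents that preserve a given
  inequality \<open>A \<le> B\<close> form a closed set containing \<open>0\<close>, \<open>1\<close> and, by the Cauchy--Schwarz type estimate
  \<open>inner_am_gm\<close>, the midpoint of any two of its elements.\<close>

section \<open>Adjoints and unitary matrices\<close>

lemma adjoint_conv_mat:
  "mat_adjoint (A :: complex mat) = mat (dim_col A) (dim_row A) (\<lambda>(i,j). cnj (A $$ (j,i)))"
  unfolding mat_adjoint_def
  by (rule eq_matI) (auto simp: mat_of_rows_def)

lemma dim_adjoint [simp]:
  "dim_row (mat_adjoint (A :: complex mat)) = dim_col A"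
  "dim_col (mat_adjoint (A :: complex mat)) = dim_row A"
  unfolding adjoint_conv_mat by simp_all

lemma index_adjoint [simp]:
  "i < dim_col A \<Longrightarrow> j < dim_row A \<Longrightarrow> mat_adjoint (A :: complex mat) $$ (i,j) = cnj (A $$ (j,i))"
  unfolding adjoint_conv_mat by simp

lemma adjoint_adjoint [simp]: "mat_adjoint (mat_adjoint (A :: complex mat)) = A"
  by (rule eq_matI) auto

lemma adjoint_mult:
  assumes "A \<in> carrier_mat n k" "B \<in> carrier_mat k l"
  shows "mat_adjoint (A * B :: complex mat) = mat_adjoint B * mat_adjoint A"
  using assms by (intro eq_matI) (auto simp: scalar_prod_def intro!: sum.cong)

lemma adjoint_one [simp]: "mat_adjoint (1\<^sub>m n :: complex mat) = 1\<^sub>m n"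
  by (rule eq_matI) auto

lemma adjoint_mat_diag [simp]:
  "mat_adjoint (mat_diag n d :: complex mat) = mat_diag n (\<lambda>i. cnj (d i))"
  by (rule eq_matI) (auto simp: mat_diag_def)

lemma square_mult_carrier [simp]:
  "A \<in> carrier_mat n n \<Longrightarrow> B \<in> carrier_mat n n \<Longrightarrow> A * B \<in> carrier_mat n n"
  by (rule mult_carrier_mat)

lemma square_mult_assoc:
  "A \<in> carrier_mat n n \<Longrightarrow> B \<in> carrier_mat n n \<Longrightarrow> C \<in> carrier_mat n n \<Longrightarrow>
    A * B * C = A * (B * C)"
  by (rule assoc_mult_mat)

lemma unitary_matD:
  assumes "unitary_mat n U"
  shows "U \<in> carrier_mat n n" "mat_adjoint U \<in> carrier_mat n n"
    "U * mat_adjoint U = 1\<^sub>m n" "mat_adjoint U * U = 1\<^sub>m n"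
  using assms unfolding unitary_mat_def by auto

lemma unitary_matI:
  assumes "U \<in> carrier_mat n n" "mat_adjoint U * U = 1\<^sub>m n"
  shows "unitary_mat n U"
  using assms mat_mult_left_right_inverse[of "mat_adjoint U" n U]
  unfolding unitary_mat_def by auto

lemma unitary_cancel:
  assumes "unitary_mat n U" and "X \<in> carrier_mat n k"
  shows "U * (mat_adjoint U * X) = X" "mat_adjoint U * (U * X) = X"
  using unitary_matD[OF assms(1)] assms(2)
  by (simp_all flip: assoc_mult_mat[of _ n n _ n _ k])

lemma unitary_mult:
  assumes U: "unitary_mat n U" and V: "unitary_mat n V"
  shows "unitary_mat n (U * V)"
proof (rule unitary_matI)
  note u = unitary_matD[OF U] and v = unitary_matD[OF V]
  show "U * V \<in> carrier_mat n n" using u v by auto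
  show "mat_adjoint (U * V) * (U * V) = 1\<^sub>m n"
    using u v by (simp add: adjoint_mult[of _ n n _ n] square_mult_assoc[of _ n]
      unitary_cancel[OF U])
qed

lemma adjoint_four_block:
  assumes "A \<in> carrier_mat a b" "B \<in> carrier_mat a d" "C \<in> carrier_mat c b" "D \<in> carrier_mat c d"
  shows "mat_adjoint (four_block_mat A B C D :: complex mat) =
    four_block_mat (mat_adjoint A) (mat_adjoint C) (mat_adjoint B) (mat_adjoint D)"
  using assms by (intro eq_matI) (auto simp: Let_def)

section \<open>The spectral theorem with sorted eigenvalues\<close>

text \<open>Complete \<open>v\<close> to a basis, orthogonalize it by Gram--Schmidt (which keeps the first
  vector) and normalize the columns. This is the step that makes the diagonalization
  below unitary instead of a mere similarity.\<close>

lemma unitary_with_first_column: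
  fixes v :: "complex vec"
  assumes v: "v \<in> carrier_vec n" and v0: "v \<noteq> 0\<^sub>v n"
  shows "\<exists>U c. unitary_mat n U \<and> col U 0 = c \<cdot>\<^sub>v v"
proof -
  interpret cof_vec_space n "TYPE(complex)" .
  from v v0 have n: "n > 0" by (cases n) auto
  define ws where "ws = gram_schmidt n (basis_completion v)"
  note bc = basis_completion[OF v v0]
  from bc n obtain vs where bv: "basis_completion v = v # vs"
    by (cases "basis_completion v") auto
  have ws: "set ws \<subseteq> carrier_vec n" "corthogonal ws" "length ws = n"
    using gram_schmidt_result[OF bc(2,4,5) refl] bc(6) unfolding ws_def by auto
  have "hd ws = v" unfolding ws_def bv by (rule gram_schmidt_hd[OF v])
  then have ws0: "ws ! 0 = v" using ws n by (cases ws) auto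
  have wsc: "ws ! i \<in> carrier_vec n" if "i < n" for i using ws that by auto
  \<comment> \<open>the factors that normalize the orthogonal columns\<close>
  define r where "r i = complex_of_real (1 / sqrt (Re (ws ! i \<bullet>c ws ! i)))" for i
  define U where "U = mat n n (\<lambda>(j,i). r i * ws ! i $ j)"
  have Uc: "U \<in> carrier_mat n n" unfolding U_def by simp
  have "mat_adjoint U * U = 1\<^sub>m n"
  proof (rule eq_matI)
    fix i j assume "i < dim_row (1\<^sub>m n :: complex mat)" "j < dim_col (1\<^sub>m n :: complex mat)"
    then have ij: "i < n" "j < n" by auto
    have "(mat_adjoint U * U) $$ (i,j) = (\<Sum>k<n. cnj (U $$ (k,i)) * U $$ (k,j))"
      using ij Uc by (auto simp: scalar_prod_def atLeast0LessThan)
    also have "\<dots> = (\<Sum>k<n. r i * r j * (ws ! j $ k * cnj (ws ! i $ k)))"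
      unfolding U_def r_def using ij by (auto intro!: sum.cong)
    also have "\<dots> = r i * r j * (ws ! j \<bullet>c ws ! i)"
      using wsc[OF ij(1)] wsc[OF ij(2)]
      by (simp add: scalar_prod_def atLeast0LessThan sum_distrib_left)
    also have "\<dots> = (if i = j then 1 else 0)"
    proof (cases "i = j")
      case False
      then have "ws ! j \<bullet>c ws ! i = 0" using corthogonalD[OF ws(2), of j i] ij ws(3) by auto
      then show ?thesis using False by simp
    next
      case True
      have nz: "ws ! i \<bullet>c ws ! i \<noteq> 0" using corthogonalD[OF ws(2), of i i] ij ws(3) by auto
      have ge: "ws ! i \<bullet>c ws ! i \<ge> 0" by (rule conjugate_square_ge_0_vec)
      then have re: "ws ! i \<bullet>c ws ! i = complex_of_real (Re (ws ! i \<bullet>c ws ! i))"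
        by (auto simp: less_eq_complex_def complex_eq_iff)
      with nz ge have pos: "Re (ws ! i \<bullet>c ws ! i) > 0"
        by (metis less_eq_complex_def of_real_0 order_le_less zero_complex.sel(1))
      have "r i * r i * (ws ! i \<bullet>c ws ! i) =
        complex_of_real (1 / (sqrt (Re (ws ! i \<bullet>c ws ! i)) * sqrt (Re (ws ! i \<bullet>c ws ! i))) * Re (ws ! i \<bullet>c ws ! i))"
        unfolding r_def by (subst (3) re) (simp only: of_real_mult of_real_divide, simp)
      also have "\<dots> = 1" using pos by simp
      finally show ?thesis using True by simp
    qed
    finally show "(mat_adjoint U * U) $$ (i,j) = 1\<^sub>m n $$ (i,j)" using ij by simp
  qed (use Uc in auto)
  moreover have "col U 0 = r 0 \<cdot>\<^sub>v v"
    using n v ws0 unfolding U_def by (intro eq_vecI) auto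
  ultimately show ?thesis using unitary_matI[OF Uc] by blast
qed

text \<open>Induction on the dimension: after a unitary change of basis that starts with an
  eigenvector, the first column of the Hermitian matrix is a multiple of the first unit vector, hence
  so is its first row, and the remaining block is again Hermitian. The list of roots is an argument
  so that the order in which the eigenvalues appear on the diagonal can be prescribed.\<close>

lemma hermitian_diagonalization:
  fixes A :: "complex mat"
  assumes "A \<in> carrier_mat n n" and "mat_adjoint A = A"
    and "char_poly A = (\<Prod>e\<leftarrow>es. [:- e, 1:])"
  shows "\<exists>U. unitary_mat n U \<and> A = U * mat_diag n (\<lambda>i. es ! i) * mat_adjoint U"
  using assms
proof (induction es arbitrary: n A)
  case Nil
  have "n = 0" using degree_monic_char_poly[OF Nil(1)] Nil(3) by simp
  then have "A = 1\<^sub>m n * mat_diag n (\<lambda>i. [] ! i) * mat_adjoint (1\<^sub>m n)" "unitary_mat n (1\<^sub>m n)"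
    using Nil(1) by (auto intro!: unitary_matI)
  then show ?case by blast
next
  case (Cons e es n A)
  note A = Cons.prems(1) and herm = Cons.prems(2)
  have cp: "char_poly A = [:-e, 1:] * (\<Prod>e\<leftarrow>es. [:- e, 1:])" using Cons.prems(3) by simp
  have "eigenvalue A e" unfolding eigenvalue_root_char_poly[OF A] cp by simp
  then obtain v where v: "v \<in> carrier_vec n" "v \<noteq> 0\<^sub>v n" and ev: "A *\<^sub>v v = e \<cdot>\<^sub>v v"
    using A unfolding eigenvalue_def eigenvector_def by auto
  from v obtain k where n: "n = Suc k" by (cases n) auto
  obtain U c where U: "unitary_mat n U" and col: "col U 0 = c \<cdot>\<^sub>v v"
    using unitary_with_first_column[OF v] by blast
  note u = unitary_matD[OF U]
  define A' where "A' = mat_adjoint U * A * U"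
  have A'c: "A' \<in> carrier_mat n n" using u A unfolding A'_def by auto
  have herm': "mat_adjoint A' = A'"
    unfolding A'_def using u A
    by (simp add: adjoint_mult[of _ n n _ n] herm square_mult_assoc[of _ n])
  have AA': "A = U * A' * mat_adjoint U"
    unfolding A'_def using u A
    by (simp add: square_mult_assoc[of _ n] unitary_cancel[OF U])
  have col0: "A' $$ (i,0) = (if i = 0 then e else 0)" if i: "i < n" for i
  proof -
    have cU: "col U 0 \<in> carrier_vec n" using col_dim[of U 0] u(1) by simp
    have "col A' 0 = col (mat_adjoint U * (A * U)) 0"
      unfolding A'_def using u A by (simp add: square_mult_assoc[of _ n])
    also have "\<dots> = mat_adjoint U *\<^sub>v col (A * U) 0"
      by (rule col_mult2[of _ n n _ n]) (use u A n in auto)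
    also have "col (A * U) 0 = A *\<^sub>v col U 0"
      by (rule col_mult2[of _ n n _ n]) (use u A n in auto)
    also have "A *\<^sub>v col U 0 = e \<cdot>\<^sub>v col U 0"
      using A v(1) by (simp add: col ev mult_mat_vec smult_smult_assoc mult.commute)
    also have "mat_adjoint U *\<^sub>v (e \<cdot>\<^sub>v col U 0) = e \<cdot>\<^sub>v (mat_adjoint U *\<^sub>v col U 0)"
      by (rule mult_mat_vec[OF u(2) cU])
    also have "mat_adjoint U *\<^sub>v col U 0 = col (mat_adjoint U * U) 0"
      by (rule col_mult2[OF u(2,1), symmetric]) (use n in simp)
    also have "\<dots> = unit_vec n 0" using u n by simp
    finally have "col A' 0 $ i = (e \<cdot>\<^sub>v unit_vec n 0) $ i" by simp
    then show ?thesis using i A'c n by simp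
  qed
  have row0: "A' $$ (0,i) = (if i = 0 then cnj e else 0)" if i: "i < n" for i
  proof -
    have "A' $$ (0,i) = mat_adjoint A' $$ (0,i)" by (simp only: herm')
    then show ?thesis using col0[OF i] A'c i n by simp
  qed
  define A3 where "A3 = mat k k (\<lambda>(i,j). A' $$ (Suc i, Suc j))"
  define E where "E = mat 1 1 (\<lambda>_. e)"
  have A3: "A3 \<in> carrier_mat k k" and E: "E \<in> carrier_mat 1 1" unfolding A3_def E_def by auto
  have blk: "A' = four_block_mat E (0\<^sub>m 1 k) (0\<^sub>m k 1) A3"
  proof (rule eq_matI)
    fix i j assume "i < dim_row (four_block_mat E (0\<^sub>m 1 k) (0\<^sub>m k 1) A3)"
      "j < dim_col (four_block_mat E (0\<^sub>m 1 k) (0\<^sub>m k 1) A3)"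
    then have "i < n" "j < n" using n E A3 by auto
    then show "A' $$ (i,j) = four_block_mat E (0\<^sub>m 1 k) (0\<^sub>m k 1) A3 $$ (i,j)"
      using col0[of i] row0[of j] n E A3
      by (cases i; cases j) (auto simp: E_def A3_def)
  qed (use A'c n E A3 in auto)
  have herm3: "mat_adjoint A3 = A3"
  proof (rule eq_matI)
    fix i j assume "i < dim_row A3" "j < dim_col A3"
    then have "i < k" "j < k" using A3 by auto
    then show "mat_adjoint A3 $$ (i,j) = A3 $$ (i,j)"
      using arg_cong[OF herm', of "\<lambda>M. M $$ (Suc i, Suc j)"] A'c n
      unfolding A3_def by simp
  qed (use A3 in auto)
  have "similar_mat_wit A A' U (mat_adjoint U)"
    by (rule similar_mat_witI[OF u(3,4) AA' A A'c u(1,2)])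
  then have "similar_mat A A'" unfolding similar_mat_def by blast
  then have "char_poly A = char_poly A'" by (rule char_poly_similar)
  also have "\<dots> = char_poly E * char_poly A3"
    unfolding blk by (rule char_poly_four_block_zeros_col[OF E _ A3]) simp
  also have "char_poly E = [:-e,1:]"
    by (simp add: E_def char_poly_defs det_def sign_def)
  finally have "char_poly A3 = (\<Prod>e\<leftarrow>es. [:- e, 1:])"
    unfolding cp by (metis mult_cancel_left pCons_eq_0_iff zero_neq_one)
  from Cons.IH[OF A3 herm3 this] obtain V where V: "unitary_mat k V"
    and A3V: "A3 = V * mat_diag k (\<lambda>i. es ! i) * mat_adjoint V" by blast
  note v = unitary_matD[OF V]
  define W where "W = four_block_mat (1\<^sub>m 1) (0\<^sub>m 1 k) (0\<^sub>m k 1) V"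
  have W': "mat_adjoint W = four_block_mat (1\<^sub>m 1) (0\<^sub>m 1 k) (0\<^sub>m k 1) (mat_adjoint V)"
  proof -
    have z: "mat_adjoint (0\<^sub>m a b :: complex mat) = 0\<^sub>m b a" for a b by (rule eq_matI) auto
    show ?thesis unfolding W_def
      by (subst adjoint_four_block[of _ 1 1 _ k _ k]) (auto simp: z v)
  qed
  have Wc: "W \<in> carrier_mat n n" unfolding W_def using v n by auto
  have W: "unitary_mat n W"
  proof (rule unitary_matI[OF Wc])
    show "mat_adjoint W * W = 1\<^sub>m n"
      unfolding W' unfolding W_def
      apply (subst mult_four_block_mat[of _ 1 1 _ k _ k _ _ 1 _ k])
      using v n by (auto simp: intro!: eq_matI)
  qed
  have D: "mat_diag n (\<lambda>i. (e # es) ! i) = four_block_mat E (0\<^sub>m 1 k) (0\<^sub>m k 1) (mat_diag k (\<lambda>i. es ! i))"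
    using n by (intro eq_matI) (auto simp: E_def mat_diag_def nth_Cons')
  have "W * mat_diag n (\<lambda>i. (e # es) ! i) = four_block_mat E (0\<^sub>m 1 k) (0\<^sub>m k 1) (V * mat_diag k (\<lambda>i. es ! i))"
    unfolding W_def D
    by (subst mult_four_block_mat[of _ 1 1 _ k _ k _ _ 1 _ k]) (use v E left_mult_zero_mat[of "mat_diag k (\<lambda>i. es ! i)" k k 1] in auto)
  also have "\<dots> * mat_adjoint W = A'"
    unfolding W' blk A3V
    by (subst mult_four_block_mat[of _ 1 1 _ k _ k _ _ 1 _ k]) (use v E right_mult_zero_mat[of "V * mat_diag k (\<lambda>i. es ! i)" k k 1] in auto)
  finally have "W * mat_diag n (\<lambda>i. (e # es) ! i) * mat_adjoint W = A'" .
  then have "A = U * (W * mat_diag n (\<lambda>i. (e # es) ! i) * mat_adjoint W) * mat_adjoint U"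
    using AA' by simp
  also have "\<dots> = (U * W) * mat_diag n (\<lambda>i. (e # es) ! i) * mat_adjoint (U * W)"
    using u Wc by (simp add: adjoint_mult[of _ n n _ n] square_mult_assoc[of _ n]
      mult_carrier_mat[of _ n n])
  finally show ?case using unitary_mult[OF U W] by blast
qed

text \<open>An arbitrary ordering of the roots first shows that the eigenvalues are real; the
  decreasing list is then an ordering of the same multiset and can be put on the diagonal.\<close>

lemma hermitian_spectral:
  fixes A :: "complex mat"
  assumes A: "A \<in> carrier_mat n n" and herm: "mat_adjoint A = A"
  shows "length (eigvals_desc A) = n"
    and "\<exists>U. unitary_mat n U \<and> A = unitary_diag n U (\<lambda>i. eigvals_desc A ! i)"
proof -
  define ps where "ps = proots (char_poly A)"
  have cp: "char_poly A = (\<Prod>e\<leftarrow>es. [:- e, 1:])" if "mset es = ps" for es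
  proof -
    have "char_poly A = (\<Prod>x\<in>#ps. [:-x, 1:])"
      using complex_poly_decompose_multiset[of "char_poly A"] degree_monic_char_poly[OF A]
      unfolding ps_def by simp
    then show ?thesis unfolding that[symmetric] by (simp flip: prod_mset_prod_list)
  qed
  have len: "length es = n" if "mset es = ps" for es
    using size_proots_complex[of "char_poly A"] degree_monic_char_poly[OF A] that
    unfolding ps_def by (metis size_mset)
  obtain es where es: "mset es = ps" using ex_mset by blast
  from hermitian_diagonalization[OF A herm cp[OF es]] obtain U where U: "unitary_mat n U"
    and AU: "A = U * mat_diag n (\<lambda>i. es ! i) * mat_adjoint U" by blast
  note u = unitary_matD[OF U]
  have D: "mat_adjoint U * A * U = mat_diag n (\<lambda>i. es ! i)"
    unfolding AU using u
    by (simp add: square_mult_assoc[of _ n] unitary_cancel[OF U, of _ n] right_mult_one_mat[of _ n n])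
  have "mat_adjoint (mat_adjoint U * A * U) = mat_adjoint U * A * U"
    using u A by (simp add: adjoint_mult[of _ n n _ n] herm square_mult_assoc[of _ n])
  then have DD: "mat_diag n (\<lambda>i. cnj (es ! i)) = mat_diag n (\<lambda>i. es ! i)" unfolding D by simp
  have "cnj (es ! i) = es ! i" if "i < n" for i
    using arg_cong[OF DD, of "\<lambda>M. M $$ (i,i)"] that by (simp add: mat_diag_def)
  then have "complex_of_real (Re x) = x" if "x \<in> set es" for x
    using that len[OF es] by (metis Reals_cnj_iff in_set_conv_nth of_real_Re)
  then have "map (\<lambda>x. complex_of_real (Re x)) es = es" by (simp add: map_idI)
  then have "image_mset complex_of_real (image_mset Re ps) = ps"
    unfolding es[symmetric] by (simp add: image_mset.compositionality comp_def flip: mset_map)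
  then have es': "mset (map complex_of_real (eigvals_desc A)) = ps"
    unfolding eigvals_desc_def ps_def by simp
  show l: "length (eigvals_desc A) = n" using len[OF es'] by simp
  from hermitian_diagonalization[OF A herm cp[OF es']] obtain V where V: "unitary_mat n V"
    and AV: "A = V * mat_diag n (\<lambda>i. map complex_of_real (eigvals_desc A) ! i) * mat_adjoint V" by blast
  have "mat_diag n (\<lambda>i. map complex_of_real (eigvals_desc A) ! i) =
      mat_diag n (\<lambda>i. complex_of_real (eigvals_desc A ! i))"
    by (rule eq_matI) (auto simp: mat_diag_def l)
  then show "\<exists>U. unitary_mat n U \<and> A = unitary_diag n U (\<lambda>i. eigvals_desc A ! i)"
    using V AV unfolding unitary_diag_def by auto
qed

section \<open>Quadratic forms and positive definite matrices\<close>

lemma square_mult_vec_carrier [simp]: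
  assumes "A \<in> carrier_mat n n" "v \<in> carrier_vec n"
  shows "A *\<^sub>v v \<in> carrier_vec n" "mat_adjoint A *\<^sub>v v \<in> carrier_vec n"
  using assms by (auto intro!: mult_mat_vec_carrier[of _ n n])

lemma inner_conv_sum:
  "y \<in> carrier_vec n \<Longrightarrow> x \<bullet>c y = (\<Sum>i<n. x $ i * cnj (y $ i))"
  by (simp add: scalar_prod_def atLeast0LessThan)

lemma inner_self_conv_sum:
  assumes "v \<in> carrier_vec n"
  shows "Re (v \<bullet>c v) = (\<Sum>i<n. (cmod (v $ i))\<^sup>2)"
  unfolding inner_conv_sum[OF assms] cmod_power2
  by (simp add: power2_eq_square sum.distrib)

lemma inner_self_pos:
  assumes "v \<in> carrier_vec n" "v \<noteq> 0\<^sub>v n"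
  shows "0 < Re (v \<bullet>c v)"
proof -
  obtain i where "i < n" "v $ i \<noteq> 0" using assms by (metis carrier_vecD eq_vecI index_zero_vec)
  then show ?thesis unfolding inner_self_conv_sum[OF assms(1)]
    by (intro sum_pos2[of _ i]) auto
qed

lemma inner_adjoint:
  fixes A :: "complex mat"
  assumes A: "A \<in> carrier_mat n n" and x: "x \<in> carrier_vec n" and y: "y \<in> carrier_vec n"
  shows "(A *\<^sub>v x) \<bullet>c y = x \<bullet>c (mat_adjoint A *\<^sub>v y)"
proof -
  have *: "mat_adjoint A *\<^sub>v y \<in> carrier_vec n" using A y by simp
  have "(A *\<^sub>v x) \<bullet>c y = (\<Sum>i<n. \<Sum>j<n. A $$ (i,j) * x $ j * cnj (y $ i))"
    unfolding inner_conv_sum[OF y]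
    using A x by (auto simp: scalar_prod_def atLeast0LessThan sum_distrib_right intro!: sum.cong)
  also have "\<dots> = (\<Sum>j<n. \<Sum>i<n. A $$ (i,j) * x $ j * cnj (y $ i))" by (rule sum.swap)
  also have "\<dots> = x \<bullet>c (mat_adjoint A *\<^sub>v y)"
    unfolding inner_conv_sum[OF *]
    using A y by (auto simp: scalar_prod_def atLeast0LessThan sum_distrib_left intro!: sum.cong)
  finally show ?thesis .
qed

text \<open>This form of the Cauchy--Schwarz inequality keeps the two squared norms apart, so that each
  of them can be estimated by an inequality between quadratic forms.\<close>

lemma inner_am_gm:
  assumes x: "x \<in> carrier_vec n" and y: "y \<in> carrier_vec n"
  shows "2 * Re (x \<bullet>c y) \<le> Re (x \<bullet>c x) + Re (y \<bullet>c y)"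
proof -
  have "2 * Re (a * cnj b) \<le> (cmod a)\<^sup>2 + (cmod b)\<^sup>2" for a b
    unfolding cmod_power2
    using zero_le_power2[of "Re a - Re b"] zero_le_power2[of "Im a - Im b"]
    by (simp add: power2_eq_square algebra_simps)
  then have "(\<Sum>i<n. 2 * Re (x $ i * cnj (y $ i))) \<le> (\<Sum>i<n. (cmod (x $ i))\<^sup>2 + (cmod (y $ i))\<^sup>2)"
    by (intro sum_mono)
  then show ?thesis
    by (simp only: inner_self_conv_sum[OF x] inner_self_conv_sum[OF y])
      (simp only: inner_conv_sum[OF y] sum.distrib Re_sum sum_distrib_left)
qed

definition qform :: "complex mat \<Rightarrow> complex vec \<Rightarrow> real" where
  "qform A v = Re ((A *\<^sub>v v) \<bullet>c v)"

definition loewner_le :: "nat \<Rightarrow> complex mat \<Rightarrow> complex mat \<Rightarrow> bool" where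
  "loewner_le n A B \<longleftrightarrow> (\<forall>v\<in>carrier_vec n. qform A v \<le> qform B v)"

lemma loewner_le_refl: "loewner_le n A A"
  unfolding loewner_le_def by simp

lemma qform_sandwich:
  assumes "S \<in> carrier_mat n n" "X \<in> carrier_mat n n" "v \<in> carrier_vec n"
  shows "qform (mat_adjoint S * X * S) v = qform X (S *\<^sub>v v)"
proof -
  have "(mat_adjoint S * X * S) *\<^sub>v v = mat_adjoint S *\<^sub>v (X *\<^sub>v (S *\<^sub>v v))"
    using assms by (simp add: assoc_mult_mat_vec[of _ n n _ n] square_mult_assoc[of _ n])
  then show ?thesis
    unfolding qform_def using assms by (simp add: inner_adjoint[of _ n])
qed

lemma loewner_le_sandwich:
  assumes "loewner_le n X Y" and "S \<in> carrier_mat n n" "mat_adjoint S = S"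
    and "X \<in> carrier_mat n n" "Y \<in> carrier_mat n n"
  shows "loewner_le n (S * X * S) (S * Y * S)"
  unfolding loewner_le_def
proof
  fix v :: "complex vec" assume v: "v \<in> carrier_vec n"
  show "qform (S * X * S) v \<le> qform (S * Y * S) v"
    using assms(1) qform_sandwich[OF assms(2,4) v] qform_sandwich[OF assms(2,5) v] assms(2,3) v
    unfolding loewner_le_def by simp
qed

lemma qform_unitary_diag:
  assumes U: "unitary_mat n U" and v: "v \<in> carrier_vec n"
  shows "qform (unitary_diag n U d) v = (\<Sum>i<n. d i * (cmod ((mat_adjoint U *\<^sub>v v) $ i))\<^sup>2)"
proof -
  note u = unitary_matD[OF U]
  define w where "w = mat_adjoint U *\<^sub>v v"
  have w: "w \<in> carrier_vec n" unfolding w_def using u v by simp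
  have "qform (unitary_diag n U d) v = qform (mat_diag n (\<lambda>i. complex_of_real (d i))) w"
    using qform_sandwich[OF u(2) _ v, of "mat_diag n (\<lambda>i. complex_of_real (d i))"]
    unfolding unitary_diag_def w_def by simp
  also have "mat_diag n (\<lambda>i. complex_of_real (d i)) *\<^sub>v w = vec n (\<lambda>i. d i * w $ i)"
    using w
    by (intro eq_vecI) (auto simp: mat_diag_def scalar_prod_def if_distrib[of "\<lambda>x. x * _"] cong: if_cong)
  then have "qform (mat_diag n (\<lambda>i. complex_of_real (d i))) w = (\<Sum>i<n. d i * (cmod (w $ i))\<^sup>2)"
    unfolding qform_def cmod_power2
    by (simp add: inner_conv_sum[OF w] power2_eq_square sum.distrib distrib_left mult_ac)
  finally show ?thesis unfolding w_def .
qed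

lemma unitary_diag_one: "unitary_mat n U \<Longrightarrow> unitary_diag n U (\<lambda>_. 1) = 1\<^sub>m n"
  using unitary_matD[of n U] unfolding unitary_diag_def by simp

lemma unitary_diag_cong:
  assumes "\<And>i. i < n \<Longrightarrow> d i = e i"
  shows "unitary_diag n U d = unitary_diag n U e"
proof -
  have "mat_diag n (\<lambda>i. complex_of_real (d i)) = mat_diag n (\<lambda>i. complex_of_real (e i))"
    using assms by (intro eq_matI) (auto simp: mat_diag_def)
  then show ?thesis unfolding unitary_diag_def by simp
qed

lemma unitary_diag_mult:
  assumes "unitary_mat n U"
  shows "unitary_diag n U d * unitary_diag n U e = unitary_diag n U (\<lambda>i. d i * e i)"
proof -
  note u = unitary_matD[OF assms]
  define D E where "D = mat_diag n (\<lambda>i. complex_of_real (d i))"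
    and "E = mat_diag n (\<lambda>i. complex_of_real (e i))"
  have c: "D \<in> carrier_mat n n" "E \<in> carrier_mat n n" unfolding D_def E_def by auto
  have "U * D * mat_adjoint U * (U * E * mat_adjoint U) = U * (D * E) * mat_adjoint U"
    using u c by (simp add: square_mult_assoc[of _ n] unitary_cancel[OF assms, of _ n])
  then show ?thesis unfolding unitary_diag_def D_def E_def by simp
qed

lemma adjoint_unitary_diag:
  assumes "unitary_mat n U"
  shows "mat_adjoint (unitary_diag n U d) = unitary_diag n U d"
  using unitary_matD[OF assms] unfolding unitary_diag_def
  by (simp add: adjoint_mult[of _ n n _ n] square_mult_assoc[of _ n])

lemma smult_unitary_diag:
  assumes "unitary_mat n U"
  shows "complex_of_real c \<cdot>\<^sub>m unitary_diag n U d = unitary_diag n U (\<lambda>i. c * d i)"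
proof -
  note u = unitary_matD[OF assms]
  have "mat_diag n (\<lambda>i. complex_of_real (c * d i)) = complex_of_real c \<cdot>\<^sub>m mat_diag n (\<lambda>i. complex_of_real (d i))"
    by (intro eq_matI) (auto simp: mat_diag_def)
  then show ?thesis unfolding unitary_diag_def using u
    by (simp add: mult_smult_distrib[of _ n n _ n] mult_smult_assoc_mat[of _ n n _ n])
qed

text \<open>The columns of \<open>U\<close> are eigenvectors; evaluating the quadratic form at such a column
  isolates one eigenvalue.\<close>

lemma unitary_column:
  assumes "unitary_mat n U" "i < n"
  defines "y \<equiv> U *\<^sub>v unit_vec n i"
  shows "y \<in> carrier_vec n" "y \<noteq> 0\<^sub>v n" "unitary_diag n U d *\<^sub>v y = complex_of_real (d i) \<cdot>\<^sub>v y"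
    "qform (unitary_diag n U d) y = d i"
proof -
  note u = unitary_matD[OF assms(1)]
  show y: "y \<in> carrier_vec n" unfolding y_def using u by simp
  have w: "mat_adjoint U *\<^sub>v y = unit_vec n i"
    unfolding y_def using u by (simp flip: assoc_mult_mat_vec[of _ n n _ n])
  show "y \<noteq> 0\<^sub>v n"
  proof
    assume "y = 0\<^sub>v n"
    then have "unit_vec n i = (0\<^sub>v n :: complex vec)"
      using w u by (metis (no_types, lifting) carrier_matD(1) eq_vecI index_mult_mat_vec dim_mult_mat_vec
          index_zero_vec scalar_prod_right_zero carrier_matD(2) row_carrier)
    then show False using arg_cong[of _ _ "\<lambda>v. v $ i"] assms(2) by fastforce
  qed
  have D: "mat_diag n (\<lambda>i. complex_of_real (d i)) *\<^sub>v unit_vec n i = complex_of_real (d i) \<cdot>\<^sub>v unit_vec n i"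
    using assms(2) by (intro eq_vecI) (auto simp: mat_diag_def)
  have "unitary_diag n U d *\<^sub>v y = U *\<^sub>v (mat_diag n (\<lambda>i. complex_of_real (d i)) *\<^sub>v (mat_adjoint U *\<^sub>v y))"
    unfolding unitary_diag_def using u y
    by (simp add: assoc_mult_mat_vec[of _ n n _ n] square_mult_assoc[of _ n])
  then show "unitary_diag n U d *\<^sub>v y = complex_of_real (d i) \<cdot>\<^sub>v y"
    unfolding w D using mult_mat_vec[OF u(1), of "unit_vec n i"] by (simp add: y_def)
  have "(cmod (unit_vec n i $ j))\<^sup>2 = (if j = i then 1 else 0)" if "j < n" for j
    using that assms(2) by simp
  then show "qform (unitary_diag n U d) y = d i"
    unfolding qform_unitary_diag[OF assms(1) y] w using assms(2)
    by (simp add: if_distrib[of "\<lambda>x. _ * x"] cong: if_cong)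
qed

lemma loewner_le_one_iff:
  assumes "unitary_mat n U"
  shows "loewner_le n (unitary_diag n U d) (1\<^sub>m n) \<longleftrightarrow> (\<forall>i<n. d i \<le> 1)"
proof
  assume L: "loewner_le n (unitary_diag n U d) (1\<^sub>m n)"
  show "\<forall>i<n. d i \<le> 1"
  proof (intro allI impI)
    fix i assume "i < n"
    note c = unitary_column[OF assms this]
    then show "d i \<le> 1"
      using L c(4)[of "\<lambda>_. 1"] c(4)[of d] unfolding loewner_le_def unitary_diag_one[OF assms]
      by (metis c(1))
  qed
next
  assume d: "\<forall>i<n. d i \<le> 1"
  show "loewner_le n (unitary_diag n U d) (1\<^sub>m n)"
    unfolding loewner_le_def unitary_diag_one[OF assms, symmetric]
  proof
    fix v :: "complex vec" assume "v \<in> carrier_vec n"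
    then show "qform (unitary_diag n U d) v \<le> qform (unitary_diag n U (\<lambda>_. 1)) v"
      unfolding qform_unitary_diag[OF assms \<open>v \<in> carrier_vec n\<close>]
      using d by (intro sum_mono mult_right_mono) auto
  qed
qed

lemma unitary_diag_pd:
  assumes U: "unitary_mat n U" and d: "\<And>i. i < n \<Longrightarrow> 0 < d i"
  shows "unitary_diag n U d \<in> pd_mats n"
proof -
  note u = unitary_matD[OF U]
  have "0 < qform (unitary_diag n U d) v" if v: "v \<in> carrier_vec n" "v \<noteq> 0\<^sub>v n" for v
  proof -
    define w where "w = mat_adjoint U *\<^sub>v v"
    have w: "w \<in> carrier_vec n" "U *\<^sub>v w = v"
      unfolding w_def using u v by (simp_all flip: assoc_mult_mat_vec[of _ n n _ n])
    have "w \<noteq> 0\<^sub>v n"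
    proof
      assume "w = 0\<^sub>v n"
      then have "v = 0\<^sub>v n" unfolding w(2)[symmetric] using u(1) by (intro eq_vecI) auto
      then show False using v by simp
    qed
    then obtain i where "i < n" "w $ i \<noteq> 0" using w by (metis carrier_vecD eq_vecI index_zero_vec)
    then show ?thesis unfolding qform_unitary_diag[OF U v(1)] w_def[symmetric]
      using d by (intro sum_pos2[of _ i]) (auto intro!: mult_nonneg_nonneg less_imp_le[OF d])
  qed
  then show ?thesis unfolding pd_mats_def
    using unitary_diag_carrier[OF U] adjoint_unitary_diag[OF U] by (auto simp: qform_def)
qed

lemma pd_matsD:
  assumes "A \<in> pd_mats n"
  shows "A \<in> carrier_mat n n" "mat_adjoint A = A"
    "\<And>v. v \<in> carrier_vec n \<Longrightarrow> v \<noteq> 0\<^sub>v n \<Longrightarrow> 0 < qform A v"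
  using assms unfolding pd_mats_def qform_def by auto

lemma pd_spectral:
  assumes A: "A \<in> pd_mats n"
  obtains U where "unitary_mat n U" "A = unitary_diag n U (\<lambda>i. eigvals_desc A ! i)"
    "\<And>i. i < n \<Longrightarrow> 0 < eigvals_desc A ! i"
proof -
  obtain U where U: "unitary_mat n U" and eq: "A = unitary_diag n U (\<lambda>i. eigvals_desc A ! i)"
    using hermitian_spectral(2)[OF pd_matsD(1,2)[OF A]] by blast
  have "0 < eigvals_desc A ! i" if i: "i < n" for i
    using pd_matsD(3)[OF A unitary_column(1,2)[OF U i]] unitary_column(4)[OF U i, of "\<lambda>i. eigvals_desc A ! i"] eq
    by simp
  with U eq that show ?thesis by blast
qed

lemma pd_sandwich:
  assumes X: "X \<in> pd_mats n" and S: "S \<in> pd_mats n"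
  shows "S * X * S \<in> pd_mats n"
proof -
  note x = pd_matsD[OF X] and s = pd_matsD[OF S]
  have "0 < qform (S * X * S) v" if v: "v \<in> carrier_vec n" "v \<noteq> 0\<^sub>v n" for v
  proof -
    have "S *\<^sub>v v \<noteq> 0\<^sub>v n"
      using s(3)[OF v] v unfolding qform_def by (auto simp: inner_conv_sum)
    then show ?thesis
      using x(3)[of "S *\<^sub>v v"] s v qform_sandwich[OF s(1) x(1) v(1)] by simp
  qed
  then show ?thesis unfolding pd_mats_def using x s
    by (auto simp: qform_def adjoint_mult[of _ n n _ n] square_mult_assoc[of _ n])
qed

section \<open>Powers of positive definite matrices\<close>

lemma mat_powr_unitary_diag:
  "unitary_mat n U \<Longrightarrow> mat_powr (unitary_diag n U d) p = unitary_diag n U (\<lambda>i. d i powr p)"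
  unfolding mat_powr_def by (rule mat_fun_unitary_diag)

lemma mat_powr_pd:
  assumes "A \<in> pd_mats n"
  shows "mat_powr A p \<in> pd_mats n"
proof -
  obtain U where U: "unitary_mat n U" "A = unitary_diag n U (\<lambda>i. eigvals_desc A ! i)"
    "\<And>i. i < n \<Longrightarrow> 0 < eigvals_desc A ! i" using pd_spectral[OF assms] by blast
  have "mat_powr A p = unitary_diag n U (\<lambda>i. (eigvals_desc A ! i) powr p)"
    by (subst U(2)) (rule mat_powr_unitary_diag[OF U(1)])
  then show ?thesis
    using unitary_diag_pd[OF U(1), of "\<lambda>i. (eigvals_desc A ! i) powr p"] U(3) by fastforce
qed

lemma mat_powr_simps:
  assumes "A \<in> pd_mats n"
  shows mat_powr_zero: "mat_powr A 0 = 1\<^sub>m n"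
    and mat_powr_one: "mat_powr A 1 = A"
    and mat_powr_powr: "mat_powr (mat_powr A p) q = mat_powr A (p * q)"
    and mat_powr_add: "mat_powr A p * mat_powr A q = mat_powr A (p + q)"
proof -
  obtain U d where U: "unitary_mat n U" and A: "A = unitary_diag n U d"
    and d: "\<And>i. i < n \<Longrightarrow> 0 < d i" using pd_spectral[OF assms] by metis
  show "mat_powr A 0 = 1\<^sub>m n"
    unfolding A mat_powr_unitary_diag[OF U] unitary_diag_one[OF U, symmetric]
    by (rule unitary_diag_cong) (use d in force)
  show "mat_powr A 1 = A"
    unfolding A mat_powr_unitary_diag[OF U]
    by (rule unitary_diag_cong) (use d in force)
  show "mat_powr (mat_powr A p) q = mat_powr A (p * q)"
    unfolding A mat_powr_unitary_diag[OF U] by (simp add: powr_powr)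
  show "mat_powr A p * mat_powr A q = mat_powr A (p + q)"
    unfolding A mat_powr_unitary_diag[OF U] unitary_diag_mult[OF U] by (simp add: powr_add)
qed

lemma mat_powr_smult:
  assumes "A \<in> pd_mats n" and c: "0 < c"
  shows "mat_powr (complex_of_real c \<cdot>\<^sub>m A) p = complex_of_real (c powr p) \<cdot>\<^sub>m mat_powr A p"
proof -
  obtain U d where U: "unitary_mat n U" and A: "A = unitary_diag n U d"
    and d: "\<And>i. i < n \<Longrightarrow> 0 < d i" using pd_spectral[OF assms(1)] by metis
  show ?thesis
    unfolding A smult_unitary_diag[OF U] mat_powr_unitary_diag[OF U]
    by (rule unitary_diag_cong) (use d c in \<open>simp add: powr_mult\<close>)
qed

lemma smult_pd:
  assumes "A \<in> pd_mats n" and c: "0 < c"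
  shows "complex_of_real c \<cdot>\<^sub>m A \<in> pd_mats n"
proof -
  obtain U d where U: "unitary_mat n U" and A: "A = unitary_diag n U d"
    and d: "\<And>i. i < n \<Longrightarrow> 0 < d i" using pd_spectral[OF assms(1)] by metis
  show ?thesis unfolding A smult_unitary_diag[OF U]
    by (rule unitary_diag_pd[OF U]) (use d c in simp)
qed

section \<open>The Loewner--Heinz inequality\<close>

text \<open>If \<open>p\<close> were missing, the midpoint of its nearest neighbours in the closed set would be a
  member strictly closer on one side.\<close>

lemma midpoint_closed_Icc:
  fixes S :: "real set"
  assumes "closed S" and "0 \<in> S" "1 \<in> S"
    and mid: "\<And>x y. x \<in> S \<Longrightarrow> y \<in> S \<Longrightarrow> (x + y) / 2 \<in> S"
    and p: "0 \<le> p" "p \<le> 1"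
  shows "p \<in> S"
proof (rule ccontr)
  assume "p \<notin> S"
  have "compact (S \<inter> {0..p})" "S \<inter> {0..p} \<noteq> {}"
    using compact_Int_closed[OF compact_Icc \<open>closed S\<close>, of 0 p] assms by (auto simp: Int_commute)
  then obtain a where "a \<in> S \<inter> {0..p}" and "\<forall>x\<in>S \<inter> {0..p}. x \<le> a"
    using compact_attains_sup by blast
  then have a: "a \<in> S" "a \<le> p" "0 \<le> a" and amax: "\<And>x. x \<in> S \<Longrightarrow> 0 \<le> x \<Longrightarrow> x \<le> p \<Longrightarrow> x \<le> a"
    by auto
  have "compact (S \<inter> {p..1})" "S \<inter> {p..1} \<noteq> {}"
    using compact_Int_closed[OF compact_Icc \<open>closed S\<close>, of p 1] assms by (auto simp: Int_commute)
  then obtain b where "b \<in> S \<inter> {p..1}" and "\<forall>x\<in>S \<inter> {p..1}. b \<le> x"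
    using compact_attains_inf by blast
  then have b: "b \<in> S" "p \<le> b" "b \<le> 1" and bmin: "\<And>x. x \<in> S \<Longrightarrow> p \<le> x \<Longrightarrow> x \<le> 1 \<Longrightarrow> b \<le> x"
    by auto
  have lt: "a < p" "p < b" using a b \<open>p \<notin> S\<close> by (auto simp: order.order_iff_strict)
  then show False
    using mid[OF a(1) b(1)] amax[of "(a + b) / 2"] bmin[of "(a + b) / 2"] a(3) b(3)
    by (cases "(a + b) / 2 \<le> p") auto
qed

lemma mat_powr_carrier:
  assumes "A \<in> pd_mats n"
  shows "mat_powr A p \<in> carrier_mat n n" "mat_adjoint (mat_powr A p) = mat_powr A p"
  using pd_matsD(1,2)[OF mat_powr_pd[OF assms]] by auto

lemma mat_powr_mult_vec:
  assumes "A \<in> pd_mats n" "v \<in> carrier_vec n"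
  shows "mat_powr A p *\<^sub>v (mat_powr A q *\<^sub>v v) = mat_powr A (p + q) *\<^sub>v v"
  using assms mat_powr_carrier[OF assms(1)]
  by (simp add: mat_powr_add[OF assms(1), symmetric] assoc_mult_mat_vec[of _ n n _ n])

text \<open>Powers are self-adjoint, so a power can be distributed unevenly over the two arguments of
  the inner product.\<close>

lemma inner_mat_powr_split:
  assumes A: "A \<in> pd_mats n" and v: "v \<in> carrier_vec n" and u: "u \<in> carrier_vec n"
  shows "(mat_powr A (p + q) *\<^sub>v v) \<bullet>c u = (mat_powr A q *\<^sub>v v) \<bullet>c (mat_powr A p *\<^sub>v u)"
  using mat_powr_carrier[OF A] v u
  by (simp add: mat_powr_mult_vec[OF A v, symmetric] inner_adjoint[of "mat_powr A p" n])

lemma qform_mat_powr: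
  assumes A: "A \<in> pd_mats n" and v: "v \<in> carrier_vec n"
  shows "qform (mat_powr A p) v = Re ((mat_powr A (p/2) *\<^sub>v v) \<bullet>c (mat_powr A (p/2) *\<^sub>v v))"
  using inner_mat_powr_split[OF A v v, of "p/2" "p/2"] unfolding qform_def by simp

lemma mat_powr_cancel_sandwich:
  assumes A: "A \<in> pd_mats n" and X: "X \<in> carrier_mat n n"
  shows "mat_powr A p * (mat_powr A (-p) * X * mat_powr A (-p)) * mat_powr A p = X"
proof -
  note c = mat_powr_carrier(1)[OF A]
  have "mat_powr A p * (mat_powr A (-p) * X * mat_powr A (-p)) * mat_powr A p =
    (mat_powr A p * mat_powr A (-p)) * X * (mat_powr A (-p) * mat_powr A p)"
    using c X by (simp add: square_mult_assoc[of _ n])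
  then show ?thesis using X by (simp add: mat_powr_add[OF A] mat_powr_zero[OF A])
qed

lemma mat_powr_sandwich_powr:
  assumes A: "A \<in> pd_mats n"
  shows "mat_powr A p * mat_powr A q * mat_powr A p = mat_powr A (2 * p + q)"
  by (simp add: mat_powr_add[OF A] algebra_simps)

text \<open>Let \<open>r\<close> be the midpoint. The claim says that no eigenvalue \<open>d\<close> of the pencil
  \<open>A\<^sup>r v = d B\<^sup>r v\<close> exceeds \<open>1\<close>. Pair this equation with the vector \<open>u\<close> for which \<open>B\<close> raised to \<open>p/2\<close>
  maps \<open>u\<close> to \<open>w\<close>, where \<open>w\<close> is the image of \<open>v\<close> under \<open>B\<close> raised to \<open>q/2\<close>. The right side becomes
  \<open>d\<close> times the squared norm of \<open>w\<close>. The left side splits into factors with exponents \<open>q/2\<close> and \<open>p/2\<close>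
  of \<open>A\<close>, whose norms are controlled by the two hypotheses, again by the norm of \<open>w\<close>.\<close>

lemma loewner_le_powr_midpoint:
  assumes A: "A \<in> pd_mats n" and B: "B \<in> pd_mats n"
    and p: "loewner_le n (mat_powr A p) (mat_powr B p)"
    and q: "loewner_le n (mat_powr A q) (mat_powr B q)"
  shows "loewner_le n (mat_powr A ((p + q) / 2)) (mat_powr B ((p + q) / 2))"
proof -
  define r where "r = (p + q) / 2"
  note ca = mat_powr_carrier[OF A] and cb = mat_powr_carrier[OF B]
  define C where "C = mat_powr B (-(r/2)) * mat_powr A r * mat_powr B (-(r/2))"
  have C: "C \<in> pd_mats n" unfolding C_def by (intro pd_sandwich mat_powr_pd A B)
  have AC: "mat_powr B (r/2) * C * mat_powr B (r/2) = mat_powr A r"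
    unfolding C_def by (rule mat_powr_cancel_sandwich[OF B ca(1)])
  note Cc = pd_matsD(1)[OF C]
  obtain U d where U: "unitary_mat n U" and Cd: "C = unitary_diag n U d"
    using pd_spectral[OF C] by metis
  have "d i \<le> 1" if i: "i < n" for i
  proof -
    obtain y where y: "y \<in> carrier_vec n" "y \<noteq> 0\<^sub>v n" "C *\<^sub>v y = complex_of_real (d i) \<cdot>\<^sub>v y"
      using unitary_column(1-3)[OF U i] unfolding Cd by metis
    \<comment> \<open>the eigenvector \<open>y\<close> of \<open>C\<close> turned into an eigenvector of the pencil\<close>
    define v where "v = mat_powr B (-(r/2)) *\<^sub>v y"
    define w where "w = mat_powr B (q/2) *\<^sub>v v"
    define u where "u = mat_powr B ((q-p)/2) *\<^sub>v v"
    have v: "v \<in> carrier_vec n" unfolding v_def using cb y by simp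
    have w: "w \<in> carrier_vec n" and u: "u \<in> carrier_vec n" unfolding w_def u_def using cb v by simp_all
    have vy: "mat_powr B (r/2) *\<^sub>v v = y" unfolding v_def
      using y by (simp add: mat_powr_mult_vec[OF B] mat_powr_zero[OF B])
    have wu: "mat_powr B (p/2) *\<^sub>v u = w"
      unfolding u_def w_def mat_powr_mult_vec[OF B v] by (simp add: field_simps)
    have "mat_powr A r *\<^sub>v v = mat_powr B (r/2) *\<^sub>v (C *\<^sub>v (mat_powr B (r/2) *\<^sub>v v))"
      unfolding AC[symmetric] using cb Cc v
      by (simp add: assoc_mult_mat_vec[of _ n n _ n] square_mult_assoc[of _ n])
    also have "\<dots> = complex_of_real (d i) \<cdot>\<^sub>v (mat_powr B (r/2) *\<^sub>v y)"
      unfolding vy y(3) by (rule mult_mat_vec[OF cb(1) y(1)])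
    also have "mat_powr B (r/2) *\<^sub>v y = mat_powr B r *\<^sub>v v"
      unfolding vy[symmetric] mat_powr_mult_vec[OF B v] by simp
    finally have Av: "mat_powr A r *\<^sub>v v = complex_of_real (d i) \<cdot>\<^sub>v (mat_powr B r *\<^sub>v v)" .
    have r: "r = p/2 + q/2" unfolding r_def by simp
    have "(mat_powr A r *\<^sub>v v) \<bullet>c u = complex_of_real (d i) * ((mat_powr B r *\<^sub>v v) \<bullet>c u)"
      unfolding Av using cb v u by (subst smult_scalar_prod_distrib[of _ n]) auto
    also have "(mat_powr B r *\<^sub>v v) \<bullet>c u = w \<bullet>c w"
      unfolding r inner_mat_powr_split[OF B v u] wu by (simp add: w_def)
    finally have "2 * (d i * Re (w \<bullet>c w)) = 2 * Re ((mat_powr A (q/2) *\<^sub>v v) \<bullet>c (mat_powr A (p/2) *\<^sub>v u))"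
      unfolding r inner_mat_powr_split[OF A v u] by simp
    also have "\<dots> \<le> qform (mat_powr A q) v + qform (mat_powr A p) u"
      unfolding qform_mat_powr[OF A v] qform_mat_powr[OF A u]
      by (rule inner_am_gm[of _ n]) (use ca v u in auto)
    also have "\<dots> \<le> qform (mat_powr B q) v + qform (mat_powr B p) u"
      using p q u v unfolding loewner_le_def by (intro add_mono) auto
    also have "\<dots> = 2 * Re (w \<bullet>c w)"
      unfolding qform_mat_powr[OF B v] qform_mat_powr[OF B u] wu by (simp add: w_def)
    finally have le: "d i * Re (w \<bullet>c w) \<le> 1 * Re (w \<bullet>c w)" by simp
    \<comment> \<open>\<open>w\<close> is nonzero because the nonzero vector \<open>y\<close> can be recovered from it\<close>
    have "mat_powr B (r/2 - q/2) *\<^sub>v w = y"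
      unfolding w_def mat_powr_mult_vec[OF B v] by (simp add: vy)
    then have "w \<noteq> 0\<^sub>v n" using y(1,2) cb(1)[of "r/2 - q/2"] by (auto intro!: eq_vecI)
    from mult_right_le_imp_le[OF le inner_self_pos[OF w this]] show ?thesis .
  qed
  then have "loewner_le n C (1\<^sub>m n)" unfolding Cd loewner_le_one_iff[OF U] by simp
  from loewner_le_sandwich[OF this cb(1,2)[of "r/2"] Cc]
  have "loewner_le n (mat_powr A r) (mat_powr B (r/2) * 1\<^sub>m n * mat_powr B (r/2))"
    unfolding AC by simp
  also have "mat_powr B (r/2) * 1\<^sub>m n * mat_powr B (r/2) = mat_powr B r"
    using cb(1)[of "r/2"] by (simp add: mat_powr_add[OF B])
  finally show ?thesis unfolding r_def .
qed

text \<open>The set of admissible exponents is closed since each quadratic form depends continuously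
  on the exponent, it contains \<open>0\<close> and \<open>1\<close>, and with any two exponents their midpoint.\<close>

theorem loewner_heinz:
  assumes A: "A \<in> pd_mats n" and B: "B \<in> pd_mats n"
    and AB: "loewner_le n A B" and p: "0 \<le> p" "p \<le> 1"
  shows "loewner_le n (mat_powr A p) (mat_powr B p)"
proof -
  define S where "S = {p. loewner_le n (mat_powr A p) (mat_powr B p)}"
  have cont: "continuous_on UNIV (\<lambda>p. qform (mat_powr X p) v)"
    if X: "X \<in> pd_mats n" and v: "v \<in> carrier_vec n" for X v
  proof -
    obtain U d where U: "unitary_mat n U" and Xd: "X = unitary_diag n U d"
      and d: "\<And>i. i < n \<Longrightarrow> 0 < d i" using pd_spectral[OF X] by metis
    show ?thesis unfolding Xd mat_powr_unitary_diag[OF U] qform_unitary_diag[OF U v]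
      by (intro continuous_intros) (use d in force)
  qed
  have "S = (\<Inter>v\<in>carrier_vec n. {p. qform (mat_powr A p) v \<le> qform (mat_powr B p) v})"
    unfolding S_def loewner_le_def by auto
  then have "closed S" using cont[OF A] cont[OF B] by (auto intro!: closed_INT closed_Collect_le)
  moreover have "0 \<in> S" "1 \<in> S"
    unfolding S_def using AB
    by (simp_all add: mat_powr_zero[OF A] mat_powr_zero[OF B] mat_powr_one[OF A] mat_powr_one[OF B] loewner_le_refl)
  moreover have "(x + y) / 2 \<in> S" if "x \<in> S" "y \<in> S" for x y
    using that loewner_le_powr_midpoint[OF A B] unfolding S_def by simp
  ultimately have "p \<in> S" using midpoint_closed_Icc[OF _ _ _ _ p] by blast
  then show ?thesis unfolding S_def by simp
qed

section \<open>The operator inequality behind the majorization\<close>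

text \<open>With \<open>S\<close> and \<open>T\<close> the square roots of \<open>X\<close> and \<open>Y\<close>, hypothesis and conclusion both say that
  an operator is a contraction: \<open>S Y S\<close> is \<open>(T S)\<^sup>* (T S)\<close> and \<open>T X T\<close> is \<open>(T S) (T S)\<^sup>*\<close>, and an
  operator is a contraction iff its adjoint is.\<close>

lemma sandwich_le_one_swap:
  assumes X: "X \<in> pd_mats n" and Y: "Y \<in> pd_mats n"
    and le: "loewner_le n (mat_powr X (1/2) * Y * mat_powr X (1/2)) (1\<^sub>m n)"
  shows "loewner_le n (mat_powr Y (1/2) * X * mat_powr Y (1/2)) (1\<^sub>m n)"
  unfolding loewner_le_def
proof
  fix v :: "complex vec" assume v: "v \<in> carrier_vec n"
  define S T where "S = mat_powr X (1/2)" and "T = mat_powr Y (1/2)"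
  have c: "S \<in> carrier_mat n n" "mat_adjoint S = S" "T \<in> carrier_mat n n" "mat_adjoint T = T"
    unfolding S_def T_def using mat_powr_carrier[OF X] mat_powr_carrier[OF Y] by auto
  have SS: "X = S * S" and TT: "Y = T * T"
    unfolding S_def T_def by (simp_all add: mat_powr_add[OF X] mat_powr_add[OF Y] mat_powr_one[OF X] mat_powr_one[OF Y])
  define w where "w = S *\<^sub>v (T *\<^sub>v v)"
  define x where "x = T *\<^sub>v (S *\<^sub>v w)"
  have w: "w \<in> carrier_vec n" and x: "x \<in> carrier_vec n" unfolding x_def w_def using c v by simp_all
  have "qform (S * Y * S) w = Re (x \<bullet>c x)"
    unfolding qform_def TT x_def using c w
    by (simp add: assoc_mult_mat_vec[of _ n n _ n] square_mult_assoc[of _ n] inner_adjoint[of S n] inner_adjoint[of T n])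
  \<comment> \<open>\<open>w\<close> is the image of \<open>v\<close> under the adjoint of the contraction \<open>T S\<close>, and \<open>x\<close> the image of \<open>w\<close> under \<open>T S\<close>\<close>
  then have xw: "Re (x \<bullet>c x) \<le> Re (w \<bullet>c w)"
    using bspec[OF le[folded S_def, unfolded loewner_le_def] w] w by (simp add: qform_def)
  have q: "(T * X * T) *\<^sub>v v = x" 
    unfolding SS x_def w_def using c v by (simp add: assoc_mult_mat_vec[of _ n n _ n] square_mult_assoc[of _ n])
  have "x \<bullet>c v = w \<bullet>c w"
    unfolding x_def using c w v by (simp add: inner_adjoint[of S n] inner_adjoint[of T n]) (simp add: w_def)
  then have "2 * Re (w \<bullet>c w) \<le> Re (x \<bullet>c x) + Re (v \<bullet>c v)"
    using inner_am_gm[OF x v] by simp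
  with xw have "Re (w \<bullet>c w) \<le> Re (v \<bullet>c v)" by simp
  then show "qform (mat_powr Y (1/2) * X * mat_powr Y (1/2)) v \<le> qform (1\<^sub>m n) v"
    unfolding qform_def T_def[symmetric] q using \<open>x \<bullet>c v = w \<bullet>c w\<close> v by simp
qed

lemma geom_mean_inv:
  assumes A: "A \<in> pd_mats n" and B: "B \<in> pd_mats n"
  shows "geom_mean t (mat_powr A (-1)) B =
    mat_powr A (-(1/2)) * mat_powr (mat_powr A (1/2) * B * mat_powr A (1/2)) t * mat_powr A (-(1/2))"
  unfolding geom_mean_def by (simp add: mat_powr_powr[OF A])

lemma geom_mean_inv_pd:
  assumes A: "A \<in> pd_mats n" and B: "B \<in> pd_mats n"
  shows "geom_mean t (mat_powr A (-1)) B \<in> pd_mats n"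
  unfolding geom_mean_inv[OF A B] by (intro pd_sandwich mat_powr_pd A B)

lemma F_mean_pd:
  assumes A: "A \<in> pd_mats n" and B: "B \<in> pd_mats n"
  shows "F_mean t A B \<in> pd_mats n"
  unfolding F_mean_def by (intro pd_sandwich mat_powr_pd geom_mean_inv_pd A B)

lemma Q_mean_pd:
  assumes A: "A \<in> pd_mats n" and B: "B \<in> pd_mats n"
  shows "Q_mean t z A B \<in> pd_mats n"
  unfolding Q_mean_def by (intro pd_sandwich mat_powr_pd A B)

lemma loewner_le_one_powr:
  assumes A: "A \<in> pd_mats n" and z: "0 < z" and le: "loewner_le n (mat_powr A z) (1\<^sub>m n)"
  shows "loewner_le n A (1\<^sub>m n)"
proof -
  obtain U d where U: "unitary_mat n U" and Ad: "A = unitary_diag n U d"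
    and d: "\<And>i. i < n \<Longrightarrow> 0 < d i" using pd_spectral[OF A] by metis
  have "d i \<le> 1" if "i < n" for i
  proof (rule ccontr)
    assume "\<not> d i \<le> 1"
    then have "1 < d i powr z" using powr_less_mono2[of z 1 "d i"] z by simp
    then show False
      using le that unfolding Ad mat_powr_unitary_diag[OF U] loewner_le_one_iff[OF U] by force
  qed
  then show ?thesis unfolding Ad loewner_le_one_iff[OF U] by simp
qed

text \<open>The successive bounds are \<open>B \<le> A\<^sup>e\<close> with \<open>e = -(1-t)/t\<close> (exponent \<open>z/t\<close>), the bound of
  the geometric mean \<open>G\<close> by \<open>A\<close> raised to \<open>2t-2\<close> (exponent \<open>t\<close>), and finally a swap of the roles of
  \<open>G\<close> and the power of \<open>A\<close> in the sandwich, which gives the form in which \<open>F\<close> is defined.\<close>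

theorem F_mean_le_one:
  assumes A: "A \<in> pd_mats n" and B: "B \<in> pd_mats n"
    and zt: "0 < z" "z \<le> t" "t \<le> 1"
    and le: "loewner_le n (Q_mean t z A B) (1\<^sub>m n)"
  shows "loewner_le n (F_mean t A B) (1\<^sub>m n)"
proof -
  have t: "0 < t" using zt by simp
  define P where "P p = mat_powr A p" for p
  have P: "P p \<in> pd_mats n" for p unfolding P_def by (rule mat_powr_pd[OF A])
  have Pc: "P p \<in> carrier_mat n n" "mat_adjoint (P p) = P p" for p using pd_matsD(1,2)[OF P] by auto
  have Psand: "P p * P q * P p = P (2 * p + q)" for p q unfolding P_def by (rule mat_powr_sandwich_powr[OF A])
  have Ppow: "mat_powr (P p) q = P (p * q)" for p q unfolding P_def by (rule mat_powr_powr[OF A])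
  define s where "s = (1 - t) / (2 * z)"
  have Bz: "mat_powr B (t/z) \<in> pd_mats n" by (rule mat_powr_pd[OF B])
  have "loewner_le n (P s * mat_powr B (t/z) * P s) (1\<^sub>m n)"
    using loewner_le_one_powr[OF pd_sandwich[OF Bz P[of s]] zt(1)] le
    unfolding Q_mean_def P_def s_def .
  from loewner_le_sandwich[OF this Pc[of "-s"] pd_matsD(1)[OF pd_sandwich[OF Bz P]]]
  have "loewner_le n (mat_powr B (t/z)) (P (-s) * P 0 * P (-s))"
    using mat_powr_cancel_sandwich[OF A pd_matsD(1)[OF Bz], of "-s"]
    unfolding P_def by (simp add: mat_powr_zero[OF A])
  then have "loewner_le n (mat_powr B (t/z)) (P (-(2*s)))" unfolding Psand by simp
  from loewner_heinz[OF Bz P this, of "z/t"] zt t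
  have "loewner_le n (mat_powr (mat_powr B (t/z)) (z/t)) (P (-(2*s) * (z/t)))"
    unfolding Ppow by simp
  moreover have "mat_powr (mat_powr B (t/z)) (z/t) = B"
    using zt t by (simp add: mat_powr_powr[OF B] mat_powr_one[OF B])
  moreover have "-(2*s) * (z/t) = -(1-t)/t" unfolding s_def using zt t by (simp add: field_simps)
  ultimately have "loewner_le n B (P (-(1-t)/t))" by simp
  from loewner_le_sandwich[OF this Pc[of "1/2"] pd_matsD(1)[OF B] Pc(1)]
  have "loewner_le n (P (1/2) * B * P (1/2)) (P (1 + -(1-t)/t))" unfolding Psand by simp
  from loewner_heinz[OF pd_sandwich[OF B P] P this, of t]
  have "loewner_le n (mat_powr (P (1/2) * B * P (1/2)) t) (P ((1 + -(1-t)/t) * t))"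
    unfolding Ppow using t zt by simp
  moreover have "(1 + -(1-t)/t) * t = 2*t - 1" using t by (simp add: field_simps)
  ultimately have le2: "loewner_le n (mat_powr (P (1/2) * B * P (1/2)) t) (P (2*t - 1))" by simp
  define G where "G = geom_mean t (mat_powr A (-1)) B"
  have G: "G \<in> pd_mats n" unfolding G_def by (rule geom_mean_inv_pd[OF A B])
  have "loewner_le n G (P (-(1/2)) * P (2*t - 1) * P (-(1/2)))"
    using loewner_le_sandwich[OF le2 Pc[of "-(1/2)"] pd_matsD(1)[OF mat_powr_pd[OF pd_sandwich[OF B P]]] Pc(1)]
    unfolding G_def geom_mean_inv[OF A B] P_def .
  then have "loewner_le n G (P (2*t - 2))" unfolding Psand by simp
  from loewner_le_sandwich[OF this Pc[of "1 - t"] pd_matsD(1)[OF G] Pc(1)]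
  have "loewner_le n (P (1 - t) * G * P (1 - t)) (1\<^sub>m n)"
    unfolding Psand by (simp add: P_def mat_powr_zero[OF A])
  moreover have half: "(2 - 2*t) * (1/2) = 1 - t" by simp
  ultimately have "loewner_le n (mat_powr (P (2 - 2*t)) (1/2) * G * mat_powr (P (2 - 2*t)) (1/2)) (1\<^sub>m n)"
    unfolding Ppow half by simp
  from sandwich_le_one_swap[OF P G this]
  show ?thesis unfolding F_mean_def G_def P_def .
qed

lemma smult_sandwich:
  assumes "X \<in> carrier_mat n n" "S \<in> carrier_mat n n"
  shows "S * (c \<cdot>\<^sub>m X) * S = (c :: complex) \<cdot>\<^sub>m (S * X * S)"
  using assms by (simp add: mult_smult_distrib[of _ n n _ n] mult_smult_assoc_mat[of _ n n _ n])

lemma smult_smult_mat: "a \<cdot>\<^sub>m (b \<cdot>\<^sub>m X) = (a * b :: complex) \<cdot>\<^sub>m X"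
  by (rule eq_matI) auto

text \<open>Homogeneity in \<open>B\<close>, of the same degree \<open>t\<close> for both means, reduces a comparison of
  largest eigenvalues to a comparison with the identity.\<close>

lemma F_mean_smult:
  assumes A: "A \<in> pd_mats n" and B: "B \<in> pd_mats n" and c: "0 < c"
  shows "F_mean t A (complex_of_real c \<cdot>\<^sub>m B) = complex_of_real (c powr t) \<cdot>\<^sub>m F_mean t A B"
proof -
  define G where "G = geom_mean t (mat_powr A (-1)) B"
  have G: "G \<in> pd_mats n" unfolding G_def by (rule geom_mean_inv_pd[OF A B])
  have "geom_mean t (mat_powr A (-1)) (complex_of_real c \<cdot>\<^sub>m B) = complex_of_real (c powr t) \<cdot>\<^sub>m G"
    unfolding G_def geom_mean_inv[OF A B] geom_mean_inv[OF A smult_pd[OF B c]]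
    using mat_powr_carrier(1)[OF A] pd_matsD(1)[OF B]
      pd_sandwich[OF B mat_powr_pd[OF A, of "1/2"]]
    by (simp add: smult_sandwich[of _ n] mat_powr_smult[OF _ c] mat_powr_carrier(1)[of _ n])
  then show ?thesis
    unfolding F_mean_def using mat_powr_carrier(1)[OF G] mat_powr_carrier(1)[OF A] c
    by (simp add: G_def[symmetric] mat_powr_smult[OF G] powr_powr mult_smult_distrib[of _ n n _ n]
        mult_smult_assoc_mat[of _ n n _ n] smult_smult_mat flip: of_real_mult powr_add)
qed

lemma Q_mean_smult:
  assumes A: "A \<in> pd_mats n" and B: "B \<in> pd_mats n" and c: "0 < c" and z: "0 < z"
  shows "Q_mean t z A (complex_of_real c \<cdot>\<^sub>m B) = complex_of_real (c powr t) \<cdot>\<^sub>m Q_mean t z A B"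
proof -
  note X = pd_sandwich[OF mat_powr_pd[OF B, of "t/z"] mat_powr_pd[OF A, of "(1 - t) / (2 * z)"]]
  show ?thesis
    unfolding Q_mean_def using mat_powr_carrier(1)[OF A] mat_powr_carrier(1)[OF B] c z
    by (simp add: mat_powr_smult[OF B] smult_sandwich[of _ n] mat_powr_smult[OF X] powr_powr)
qed

section \<open>Compound matrices\<close>

definition ksubsets :: "nat \<Rightarrow> nat \<Rightarrow> nat set set" where
  "ksubsets m k = {S. S \<subseteq> {..<m} \<and> card S = k}"

abbreviation enum :: "nat set \<Rightarrow> nat \<Rightarrow> nat" where
  "enum S i \<equiv> sorted_list_of_set S ! i"

lemma finite_ksubsets: "finite (ksubsets m k)"
  unfolding ksubsets_def by (rule finite_subset[of _ "Pow {..<m}"]) auto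

lemma ksubsets_enum:
  assumes "S \<in> ksubsets m k"
  shows "bij_betw (enum S) {0..<k} S" "i < k \<Longrightarrow> enum S i < m"
proof -
  have fin: "finite S" "S \<subseteq> {..<m}" "card S = k"
    using assms finite_subset[of S "{..<m}"] unfolding ksubsets_def by auto
  show b: "bij_betw (enum S) {0..<k} S"
    using fin by (intro bij_betw_nth) auto
  show "enum S i < m" if "i < k" using bij_betwE[OF b] that fin by auto
qed

text \<open>An injection with image \<open>R\<close> is the increasing enumeration of \<open>R\<close> after a unique
  permutation. This organizes the sum over injections in the proof of the Cauchy--Binet formula.\<close>

lemma injections_onto_ksubset:
  assumes R: "R \<in> ksubsets m k"
  shows "bij_betw (\<lambda>p. restrict (enum R \<circ> p) {0..<k}) {p. p permutes {0..<k}}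
    {f \<in> {0..<k} \<rightarrow>\<^sub>E {..<m}. inj_on f {0..<k} \<and> f ` {0..<k} = R}"
    (is "bij_betw ?h ?P ?F")
proof -
  let ?K = "{0..<k}"
  note b = ksubsets_enum(1)[OF R]
  have RM: "R \<subseteq> {..<m}" using R unfolding ksubsets_def by simp
  have "inj_on ?h ?P"
  proof (rule inj_onI)
    fix p q assume "p \<in> ?P" "q \<in> ?P" and eq: "?h p = ?h q"
    then have pq: "p permutes ?K" "q permutes ?K" by auto
    have "p i = q i" if "i < k" for i
      using fun_cong[OF eq, of i] that bij_betw_imp_inj_on[OF b]
        permutes_in_image[OF pq(1), of i] permutes_in_image[OF pq(2), of i]
      by (auto dest: inj_onD)
    moreover have "p i = q i" if "\<not> i < k" for i using pq that by (auto simp: permutes_def)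
    ultimately show "p = q" by blast
  qed
  moreover have "?h p \<in> ?F" if "p \<in> ?P" for p
  proof -
    have "bij_betw (enum R \<circ> p) ?K R"
      using that b by (intro bij_betw_trans[of p ?K ?K]) (auto simp: permutes_imp_bij)
    then have "bij_betw (?h p) ?K R" by (subst bij_betw_cong[of _ _ "enum R \<circ> p"]) auto
    then show ?thesis using RM by (auto simp: bij_betw_def)
  qed
  moreover have "f \<in> ?h ` ?P" if f: "f \<in> ?F" for f
  proof -
    define p where "p i = (if i < k then the_inv_into ?K (enum R) (f i) else i)" for i
    have bf: "bij_betw f ?K R" using f by (auto simp: bij_betw_def)
    have "bij_betw (the_inv_into ?K (enum R) \<circ> f) ?K ?K"
      by (rule bij_betw_trans[OF bf bij_betw_the_inv_into[OF b]])
    then have "bij_betw p ?K ?K"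
      by (subst bij_betw_cong[of _ _ "the_inv_into ?K (enum R) \<circ> f"]) (auto simp: p_def)
    then have p: "p permutes ?K" by (rule bij_imp_permutes) (auto simp: p_def)
    have "?h p i = f i" for i
    proof (cases "i < k")
      case True
      then have "f i \<in> R" using f by auto
      then show ?thesis using True f_the_inv_into_f_bij_betw[OF b] by (simp add: p_def)
    next
      case False
      then show ?thesis using f by (auto simp: PiE_def extensional_def)
    qed
    then show ?thesis using p by (intro image_eqI[of _ _ p]) auto
  qed
  ultimately show ?thesis unfolding bij_betw_def by blast
qed

text \<open>Expanding the product by multilinearity in the rows gives a sum over all maps \<open>f\<close> from row
  indices to \<open>{..<m}\<close>. Maps with a repeated value contribute a determinant with two equal rows; the
  injections are grouped by their image \<open>R\<close>, and each group is a product of two Leibniz formulas.\<close>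

theorem cauchy_binet:
  fixes a b :: "nat \<Rightarrow> nat \<Rightarrow> complex"
  shows "det (mat k k (\<lambda>(i,j). \<Sum>l<m. a i l * b l j)) =
    (\<Sum>R\<in>ksubsets m k. det (mat k k (\<lambda>(i,j). a i (enum R j))) * det (mat k k (\<lambda>(i,j). b (enum R i) j)))"
proof -
  let ?K = "{0..<k}"
  let ?P = "{p. p permutes ?K}"
  let ?F = "?K \<rightarrow>\<^sub>E {..<m}"
  let ?I = "{f \<in> ?F. inj_on f ?K}"
  define g where "g f = (\<Prod>i\<in>?K. a i (f i)) * det (mat k k (\<lambda>(i,j). b (f i) j))" for f
  have leib: "det (mat k k (\<lambda>(i,j). M i j)) = (\<Sum>p\<in>?P. signof p * (\<Prod>i\<in>?K. M i (p i)))"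
    for M :: "nat \<Rightarrow> nat \<Rightarrow> complex"
    unfolding det_def'[OF mat_carrier]
    by (intro sum.cong refl arg_cong2[of _ _ _ _ "(*)"] prod.cong) (auto dest: permutes_in_image)
  have finF: "finite ?F" by (intro finite_PiE) auto
  have "det (mat k k (\<lambda>(i,j). \<Sum>l<m. a i l * b l j)) =
      (\<Sum>p\<in>?P. signof p * (\<Prod>i\<in>?K. \<Sum>l<m. a i l * b l (p i)))" by (rule leib)
  also have "\<dots> = (\<Sum>p\<in>?P. signof p * (\<Sum>f\<in>?F. \<Prod>i\<in>?K. a i (f i) * b (f i) (p i)))"
    by (subst prod_sum_PiE) auto
  also have "\<dots> = (\<Sum>f\<in>?F. \<Sum>p\<in>?P. signof p * (\<Prod>i\<in>?K. a i (f i) * b (f i) (p i)))"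
    unfolding sum_distrib_left by (rule sum.swap)
  also have "\<dots> = sum g ?F"
    unfolding g_def leib by (simp add: sum_distrib_left prod.distrib mult_ac)
  also have "\<dots> = sum g ?I"
  proof (rule sum.mono_neutral_right[OF finF])
    show "\<forall>f\<in>?F - ?I. g f = 0"
    proof
      fix f assume "f \<in> ?F - ?I"
      then obtain i j where ij: "f i = f j" "i \<noteq> j" "i < k" "j < k" unfolding inj_on_def by auto
      have "det (mat k k (\<lambda>(i,j). b (f i) j)) = 0"
        by (rule det_identical_rows[OF _ ij(2-4)]) (use ij in \<open>auto intro!: eq_vecI\<close>)
      then show "g f = 0" unfolding g_def by simp
    qed
  qed auto
  also have "\<dots> = (\<Sum>R\<in>ksubsets m k. sum g {f \<in> ?I. f ` ?K = R})"
  proof (rule sum.group[symmetric])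
    show "(\<lambda>f. f ` ?K) ` ?I \<subseteq> ksubsets m k"
      unfolding ksubsets_def by (auto simp: card_image)
  qed (use finF finite_ksubsets in auto)
  also have "\<dots> = (\<Sum>R\<in>ksubsets m k. det (mat k k (\<lambda>(i,j). a i (enum R j))) * det (mat k k (\<lambda>(i,j). b (enum R i) j)))"
  proof (rule sum.cong[OF refl])
    fix R assume R: "R \<in> ksubsets m k"
    let ?B = "mat k k (\<lambda>(i,j). b (enum R i) j)"
    have "sum g {f \<in> ?I. f ` ?K = R} = sum g {f \<in> ?F. inj_on f ?K \<and> f ` ?K = R}"
      by (rule arg_cong[of _ _ "sum g"]) auto
    also have "\<dots> = (\<Sum>p\<in>?P. g (restrict (enum R \<circ> p) ?K))"
      by (rule sum.reindex_bij_betw[OF injections_onto_ksubset[OF R], symmetric])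
    also have "\<dots> = (\<Sum>p\<in>?P. (\<Prod>i\<in>?K. a i (enum R (p i))) * (signof p * det ?B))"
    proof (rule sum.cong[OF refl])
      fix p assume "p \<in> ?P"
      then have p: "p permutes ?K" by simp
      have "mat k k (\<lambda>(i,j). b (restrict (enum R \<circ> p) ?K i) j) = mat k k (\<lambda>(i,j). ?B $$ (p i, j))"
        using permutes_in_image[OF p] by (intro eq_matI) auto
      also have "det \<dots> = signof p * det ?B"
        by (rule det_permute_rows[OF mat_carrier p])
      finally show "g (restrict (enum R \<circ> p) ?K) = (\<Prod>i\<in>?K. a i (enum R (p i))) * (signof p * det ?B)"
        unfolding g_def by simp
    qed
    also have "\<dots> = det (mat k k (\<lambda>(i,j). a i (enum R j))) * det ?B"
      unfolding leib[of "\<lambda>i j. a i (enum R j)"] by (simp add: sum_distrib_left mult_ac)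
    finally show "sum g {f \<in> ?I. f ` ?K = R} =
      det (mat k k (\<lambda>(i,j). a i (enum R j))) * det (mat k k (\<lambda>(i,j). b (enum R i) j))" .
  qed
  finally show ?thesis .
qed

text \<open>Any fixed enumeration of the \<open>k\<close>-subsets serves to index the rows and columns of compound
  matrices; their order is immaterial for the spectrum.\<close>

definition ksubset_list :: "nat \<Rightarrow> nat \<Rightarrow> nat set list" where
  "ksubset_list m k = (SOME Ls. distinct Ls \<and> set Ls = ksubsets m k)"

lemma ksubset_list:
  "distinct (ksubset_list m k)" "set (ksubset_list m k) = ksubsets m k"
  using someI_ex[of "\<lambda>Ls. distinct Ls \<and> set Ls = ksubsets m k"]
    finite_distinct_list[OF finite_ksubsets[of m k]]
  unfolding ksubset_list_def by auto

abbreviation ksubset :: "nat \<Rightarrow> nat \<Rightarrow> nat \<Rightarrow> nat set" where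
  "ksubset m k i \<equiv> ksubset_list m k ! i"

definition num_ksubsets :: "nat \<Rightarrow> nat \<Rightarrow> nat" where
  "num_ksubsets m k = length (ksubset_list m k)"

lemma ksubset_bij: "bij_betw (ksubset m k) {..<num_ksubsets m k} (ksubsets m k)"
  using ksubset_list[of m k] unfolding num_ksubsets_def by (intro bij_betw_nth) auto

lemma ksubset_mem: "i < num_ksubsets m k \<Longrightarrow> ksubset m k i \<in> ksubsets m k"
  using bij_betwE[OF ksubset_bij[of m k]] by simp

definition select :: "nat \<Rightarrow> nat set \<Rightarrow> nat set \<Rightarrow> complex mat \<Rightarrow> complex mat" where
  "select k S T A = mat k k (\<lambda>(i,j). A $$ (enum S i, enum T j))"

text \<open>The \<open>k\<close>-th compound matrix, that is, the matrix of the \<open>k\<close>-th exterior power in the basis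
  of wedge products of standard basis vectors.\<close>

definition compound :: "nat \<Rightarrow> nat \<Rightarrow> complex mat \<Rightarrow> complex mat" where
  "compound m k A = mat (num_ksubsets m k) (num_ksubsets m k) (\<lambda>(i,j). det (select k (ksubset m k i) (ksubset m k j) A))"

lemma compound_carrier [simp]: "compound m k A \<in> carrier_mat (num_ksubsets m k) (num_ksubsets m k)"
  unfolding compound_def by simp

lemma compound_mult:
  assumes A: "A \<in> carrier_mat m m" and B: "B \<in> carrier_mat m m"
  shows "compound m k (A * B) = compound m k A * compound m k B"
proof (rule eq_matI)
  fix i j assume "i < dim_row (compound m k A * compound m k B)" "j < dim_col (compound m k A * compound m k B)"
  then have ij: "i < num_ksubsets m k" "j < num_ksubsets m k" unfolding compound_def by auto
  define S T where "S = ksubset m k i" and "T = ksubset m k j"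
  have ST: "S \<in> ksubsets m k" "T \<in> ksubsets m k" unfolding S_def T_def using ij ksubset_mem by auto
  have "select k S T (A * B) = mat k k (\<lambda>(i,j). \<Sum>l<m. A $$ (enum S i, l) * B $$ (l, enum T j))"
    unfolding select_def using A B ksubsets_enum(2)[OF ST(1)] ksubsets_enum(2)[OF ST(2)]
    by (intro eq_matI) (auto simp: scalar_prod_def atLeast0LessThan)
  then have "det (select k S T (A * B)) = (\<Sum>R\<in>ksubsets m k. det (select k S R A) * det (select k R T B))"
    unfolding select_def by (simp add: cauchy_binet)
  also have "\<dots> = (\<Sum>l<num_ksubsets m k. det (select k S (ksubset m k l) A) * det (select k (ksubset m k l) T B))"
    by (rule sum.reindex_bij_betw[OF ksubset_bij, symmetric])
  finally show "compound m k (A * B) $$ (i,j) = (compound m k A * compound m k B) $$ (i,j)"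
    using ij unfolding compound_def S_def T_def by (simp add: scalar_prod_def atLeast0LessThan)
qed (auto simp: compound_def)

lemma det_adjoint:
  assumes "X \<in> carrier_mat n n"
  shows "det (mat_adjoint X) = cnj (det X)"
proof -
  interpret cnj_hom: comm_ring_hom cnj by unfold_locales auto
  have "mat_adjoint X = map_mat cnj (transpose_mat X)" by (intro eq_matI) auto
  then show ?thesis using det_transpose[OF assms] by (simp add: cnj_hom.hom_det)
qed

lemma compound_adjoint:
  assumes A: "A \<in> carrier_mat m m"
  shows "compound m k (mat_adjoint A) = mat_adjoint (compound m k A)"
proof (rule eq_matI)
  fix i j assume "i < dim_row (mat_adjoint (compound m k A))" "j < dim_col (mat_adjoint (compound m k A))"
  then have ij: "i < num_ksubsets m k" "j < num_ksubsets m k" unfolding compound_def by auto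
  define S T where "S = ksubset m k i" and "T = ksubset m k j"
  have ST: "S \<in> ksubsets m k" "T \<in> ksubsets m k" unfolding S_def T_def using ij ksubset_mem by auto
  have "select k S T (mat_adjoint A) = mat_adjoint (select k T S A)"
    unfolding select_def using A ksubsets_enum(2)[OF ST(1)] ksubsets_enum(2)[OF ST(2)]
    by (intro eq_matI) auto
  then have "det (select k S T (mat_adjoint A)) = cnj (det (select k T S A))"
    by (simp add: det_adjoint[of _ k] select_def)
  then show "compound m k (mat_adjoint A) $$ (i,j) = mat_adjoint (compound m k A) $$ (i,j)"
    using ij by (simp add: compound_def S_def T_def)
qed (auto simp: compound_def)

text \<open>A minor of a diagonal matrix with different row and column sets has a vanishing row.\<close>

lemma compound_mat_diag:
  "compound m k (mat_diag m d) = mat_diag (num_ksubsets m k) (\<lambda>i. \<Prod>s\<in>ksubset m k i. d s)"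
proof (rule eq_matI)
  fix i j assume "i < dim_row (mat_diag (num_ksubsets m k) (\<lambda>i. \<Prod>s\<in>ksubset m k i. d s))"
    "j < dim_col (mat_diag (num_ksubsets m k) (\<lambda>i. \<Prod>s\<in>ksubset m k i. d s))"
  then have ij: "i < num_ksubsets m k" "j < num_ksubsets m k" unfolding mat_diag_def by auto
  define S T where "S = ksubset m k i" and "T = ksubset m k j"
  have ST: "S \<in> ksubsets m k" "T \<in> ksubsets m k" unfolding S_def T_def using ij ksubset_mem by auto
  define X where "X = select k S T (mat_diag m d)"
  have Xc: "X \<in> carrier_mat k k" unfolding X_def select_def by simp
  have X: "X $$ (a,b) = (if enum S a = enum T b then d (enum S a) else 0)" if "a < k" "b < k" for a b
    using that ksubsets_enum(2)[OF ST(1)] ksubsets_enum(2)[OF ST(2)]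
    unfolding X_def select_def by (simp add: mat_diag_def)
  have "det X = (if i = j then \<Prod>s\<in>S. d s else 0)"
  proof (cases "i = j")
    case True
    then have TS: "T = S" unfolding S_def T_def by simp
    note b = ksubsets_enum(1)[OF ST(1)]
    have X': "X $$ (a,b) = (if a = b then d (enum S a) else 0)" if "a < k" "b < k" for a b
      using X[OF that] that bij_betw_imp_inj_on[OF b] unfolding TS by (auto dest: inj_onD)
    have "det X = prod_list (diag_mat X)"
      by (rule det_upper_triangular[OF _ Xc]) (use X' Xc in auto)
    also have "\<dots> = (\<Prod>a\<in>{0..<k}. d (enum S a))"
      using Xc by (simp add: diag_mat_def X' prod.list_conv_set_nth)
    also have "\<dots> = (\<Prod>s\<in>S. d s)" by (rule prod.reindex_bij_betw[OF b])
    finally show ?thesis using True by simp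
  next
    case False
    have "S \<noteq> T" using False ij bij_betw_imp_inj_on[OF ksubset_bij[of m k]]
      unfolding S_def T_def by (auto dest: inj_onD)
    moreover have "finite S" "finite T" "card S = card T"
      using ST finite_subset[of _ "{..<m}"] unfolding ksubsets_def by auto
    ultimately have "\<not> S \<subseteq> T" using card_subset_eq by metis
    then obtain s where s: "s \<in> S" "s \<notin> T" by blast
    have "s \<in> enum S ` {0..<k}"
      using s(1) bij_betw_imp_surj_on[OF ksubsets_enum(1)[OF ST(1)]] by simp
    then obtain a where a: "a < k" "enum S a = s" by auto
    have "X $$ (a, b) = 0" if "b < k" for b
      using X[OF a(1) that] a(2) s(2) that bij_betwE[OF ksubsets_enum(1)[OF ST(2)]] by auto
    then have "(\<Prod>r = 0..<k. X $$ (r, p r)) = 0" if "p permutes {0..<k}" for p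
      using a(1) permutes_in_image[OF that, of a] by (intro prod_zero bexI[of _ a]) auto
    then show ?thesis using False unfolding det_def'[OF Xc] by (intro trans[OF sum.neutral]) auto
  qed
  then show "compound m k (mat_diag m d) $$ (i,j) = mat_diag (num_ksubsets m k) (\<lambda>i. \<Prod>s\<in>ksubset m k i. d s) $$ (i,j)"
    using ij by (simp add: compound_def X_def S_def T_def mat_diag_def)
qed (auto simp: compound_def mat_diag_def)

lemma compound_one: "compound m k (1\<^sub>m m) = 1\<^sub>m (num_ksubsets m k)"
  using compound_mat_diag[of m k "\<lambda>_. 1"] by simp

lemma compound_unitary:
  assumes "unitary_mat m U"
  shows "unitary_mat (num_ksubsets m k) (compound m k U)"
  using unitary_matD[OF assms]
  by (intro unitary_matI)
    (simp_all add: compound_one compound_adjoint[of U m, symmetric] compound_mult[of _ m, symmetric])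

text \<open>Compounds commute with diagonalization, so they commute with every functional calculus
  that is multiplicative on the eigenvalues, in particular with real powers.\<close>

lemma compound_unitary_diag:
  assumes "unitary_mat m U"
  shows "compound m k (unitary_diag m U d) =
    unitary_diag (num_ksubsets m k) (compound m k U) (\<lambda>i. \<Prod>s\<in>ksubset m k i. d s)"
  using unitary_matD[OF assms] unfolding unitary_diag_def
  by (simp add: compound_mult[of _ m] compound_adjoint[of _ m] compound_mat_diag)

section \<open>Compounds of the two means\<close>

lemma compound_pd_powr:
  assumes "A \<in> pd_mats m"
  shows compound_pd: "compound m k A \<in> pd_mats (num_ksubsets m k)"
    and compound_powr: "compound m k (mat_powr A p) = mat_powr (compound m k A) p"
proof -
  obtain U d where U: "unitary_mat m U" and A: "A = unitary_diag m U d"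
    and d: "\<And>i. i < m \<Longrightarrow> 0 < d i" using pd_spectral[OF assms] by metis
  have pos: "0 < d s" if "i < num_ksubsets m k" "s \<in> ksubset m k i" for i s
    using ksubset_mem[OF that(1)] that(2) d unfolding ksubsets_def by auto
  show "compound m k A \<in> pd_mats (num_ksubsets m k)"
    unfolding A compound_unitary_diag[OF U]
    by (rule unitary_diag_pd[OF compound_unitary[OF U]]) (auto intro!: prod_pos pos)
  show "compound m k (mat_powr A p) = mat_powr (compound m k A) p"
    unfolding A mat_powr_unitary_diag[OF U] compound_unitary_diag[OF U]
      mat_powr_unitary_diag[OF compound_unitary[OF U]]
    by (rule unitary_diag_cong) (auto intro!: prod_powr_distrib[symmetric] less_imp_le pos)
qed

lemma compound_sandwich:
  assumes "S \<in> pd_mats m" "X \<in> pd_mats m"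
  shows "compound m k (S * X * S) = compound m k S * compound m k X * compound m k S"
  using pd_matsD(1)[OF assms(1)] pd_matsD(1)[OF assms(2)] by (simp add: compound_mult[of _ m] square_mult_assoc[of _ "num_ksubsets m k"])

lemma compound_Q_mean:
  assumes A: "A \<in> pd_mats m" and B: "B \<in> pd_mats m"
  shows "compound m k (Q_mean t z A B) = Q_mean t z (compound m k A) (compound m k B)"
  using A B unfolding Q_mean_def
  by (simp add: compound_powr[OF pd_sandwich] compound_sandwich compound_powr mat_powr_pd)

lemma compound_F_mean:
  assumes A: "A \<in> pd_mats m" and B: "B \<in> pd_mats m"
  shows "compound m k (F_mean t A B) = F_mean t (compound m k A) (compound m k B)"
proof -
  note C = compound_pd[OF A, of k] compound_pd[OF B, of k]
  have "compound m k (geom_mean t (mat_powr A (-1)) B) =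
      geom_mean t (mat_powr (compound m k A) (-1)) (compound m k B)"
    unfolding geom_mean_inv[OF A B] geom_mean_inv[OF C] using A B
    by (simp add: compound_sandwich compound_powr mat_powr_pd pd_sandwich)
  then show ?thesis
    unfolding F_mean_def using A geom_mean_inv_pd[OF A B]
    by (simp add: compound_sandwich compound_powr mat_powr_pd)
qed

section \<open>Products of leading eigenvalues\<close>

text \<open>The \<open>i\<close>-th element of a set of naturals has \<open>i\<close> smaller elements below it.\<close>

lemma le_enum:
  assumes "finite S" "i < card S"
  shows "i \<le> enum S i"
  using assms(2)
proof (induction i)
  case (Suc i)
  have "enum S i < enum S (Suc i)"
    using sorted_wrt_nth_less[OF strict_sorted_list_of_set[of S], of i "Suc i"] Suc.prems by simp
  then show ?case using Suc by simp
qed simp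

text \<open>Since the enumeration of \<open>S\<close> satisfies \<open>i \<le> enum S i\<close>, the decreasing eigenvalues can be
  compared factor by factor.\<close>

lemma prod_ksubset_le_prod_top:
  assumes X: "X \<in> pd_mats m" and S: "S \<in> ksubsets m k"
  shows "(\<Prod>s\<in>S. eigvals_desc X ! s) \<le> (\<Prod>i<k. eigvals_desc X ! i)"
proof -
  define e where "e = eigvals_desc X"
  have len: "length e = m" unfolding e_def by (rule hermitian_spectral(1)[OF pd_matsD(1,2)[OF X]])
  have pos: "0 < e ! i" if "i < m" for i using pd_spectral[OF X] that unfolding e_def by metis
  have desc: "e ! j \<le> e ! i" if "i \<le> j" "j < m" for i j
    using that len by (intro sorted_rev_nth_mono) (auto simp: e_def eigvals_desc_def)
  have fin: "finite S" "card S = k" using S finite_subset[of S "{..<m}"] unfolding ksubsets_def by auto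
  have "(\<Prod>s\<in>S. e ! s) = (\<Prod>i\<in>{0..<k}. e ! enum S i)"
    by (rule prod.reindex_bij_betw[OF ksubsets_enum(1)[OF S], symmetric])
  also have "\<dots> \<le> (\<Prod>i\<in>{0..<k}. e ! i)"
    using ksubsets_enum(2)[OF S] le_enum[OF fin(1)] fin(2)
    by (intro prod_mono) (auto intro!: desc less_imp_le[OF pos])
  finally show ?thesis unfolding e_def by (simp add: atLeast0LessThan)
qed

text \<open>Let \<open>l\<close> be the product of the \<open>k\<close> leading eigenvalues of \<open>Q\<close>, the largest eigenvalue of its
  compound. Scaling the compound of \<open>B\<close> makes the compound of \<open>Q\<close> at most the identity, hence also the
  equally scaled compound of \<open>F\<close>; and the product to be bounded is an eigenvalue of the compound of \<open>F\<close>.\<close>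

lemma weak_log_majorization:
  assumes A: "A \<in> pd_mats m" and B: "B \<in> pd_mats m"
    and zt: "0 < z" "z \<le> t" "t \<le> 1" and k: "k \<le> m"
  shows "(\<Prod>i<k. eigvals_desc (F_mean t A B) ! i) \<le> (\<Prod>i<k. eigvals_desc (Q_mean t z A B) ! i)"
proof -
  define N where "N = num_ksubsets m k"
  define X where "X = F_mean t A B"
  define Y where "Y = Q_mean t z A B"
  have X: "X \<in> pd_mats m" and Y: "Y \<in> pd_mats m"
    unfolding X_def Y_def by (rule F_mean_pd[OF A B], rule Q_mean_pd[OF A B])
  obtain U where U: "unitary_mat m U" and XU: "X = unitary_diag m U (\<lambda>i. eigvals_desc X ! i)"
    using pd_spectral[OF X] by metis
  obtain V where V: "unitary_mat m V" and YV: "Y = unitary_diag m V (\<lambda>i. eigvals_desc Y ! i)"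
    and Ypos: "\<And>i. i < m \<Longrightarrow> 0 < eigvals_desc Y ! i" using pd_spectral[OF Y] by metis
  define l where "l = (\<Prod>i<k. eigvals_desc Y ! i)"
  have l: "0 < l" unfolding l_def using Ypos k by (intro prod_pos) auto
  \<comment> \<open>chosen so that both means are multiplied by \<open>c powr t = 1 / l\<close>\<close>
  define c where "c = l powr (- 1 / t)"
  have "(- 1 / t) * t = - 1" using zt by simp
  then have c: "0 < c" "c powr t = inverse l"
    unfolding c_def powr_powr using l by (simp_all add: powr_minus)
  note CA = compound_pd[OF A, of k, folded N_def] and CB = compound_pd[OF B, of k, folded N_def]
  have CX: "compound m k X = unitary_diag N (compound m k U) (\<lambda>i. \<Prod>s\<in>ksubset m k i. eigvals_desc X ! s)"
    by (subst XU) (simp only: compound_unitary_diag[OF U] N_def)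
  have CY: "compound m k Y = unitary_diag N (compound m k V) (\<lambda>i. \<Prod>s\<in>ksubset m k i. eigvals_desc Y ! s)"
    by (subst YV) (simp only: compound_unitary_diag[OF V] N_def)
  note CU = compound_unitary[OF U, of k, folded N_def] and CV = compound_unitary[OF V, of k, folded N_def]
  have "loewner_le N (complex_of_real (inverse l) \<cdot>\<^sub>m compound m k Y) (1\<^sub>m N)"
    unfolding CY smult_unitary_diag[OF CV] loewner_le_one_iff[OF CV]
    using prod_ksubset_le_prod_top[OF Y ksubset_mem[of _ m k]] l
    by (auto simp: N_def l_def[symmetric] field_simps)
  then have "loewner_le N (Q_mean t z (compound m k A) (complex_of_real c \<cdot>\<^sub>m compound m k B)) (1\<^sub>m N)"
    unfolding Y_def compound_Q_mean[OF A B] Q_mean_smult[OF CA CB c(1) zt(1)] c(2) .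
  then have "loewner_le N (F_mean t (compound m k A) (complex_of_real c \<cdot>\<^sub>m compound m k B)) (1\<^sub>m N)"
    by (rule F_mean_le_one[OF CA smult_pd[OF CB c(1)] zt])
  then have le: "loewner_le N (complex_of_real (inverse l) \<cdot>\<^sub>m compound m k X) (1\<^sub>m N)"
    unfolding X_def compound_F_mean[OF A B] F_mean_smult[OF CA CB c(1)] c(2) .
  have "{..<k} \<in> ksubsets m k" using k unfolding ksubsets_def by auto
  then obtain i where i: "i < N" "ksubset m k i = {..<k}"
    using bij_betw_imp_surj_on[OF ksubset_bij[of m k]] unfolding N_def by (metis imageE lessThan_iff)
  have "\<forall>i<N. inverse l * (\<Prod>s\<in>ksubset m k i. eigvals_desc X ! s) \<le> 1"
    using le unfolding CX smult_unitary_diag[OF CU] loewner_le_one_iff[OF CU] .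
  then have "inverse l * (\<Prod>i<k. eigvals_desc X ! i) \<le> 1" using i by force
  then show ?thesis
    using l unfolding X_def[symmetric] Y_def[symmetric] l_def[symmetric] by (simp add: field_simps)
qed

section \<open>Determinants\<close>

lemma det_unitary_diag:
  assumes "unitary_mat n U"
  shows "det (unitary_diag n U d) = complex_of_real (\<Prod>i<n. d i)"
proof -
  note u = unitary_matD[OF assms]
  define D where "D = mat_diag n (\<lambda>i. complex_of_real (d i))"
  have D: "D \<in> carrier_mat n n" unfolding D_def by simp
  have "det U * det (mat_adjoint U) = 1"
    using det_mult[OF u(1,2)] u(3) by simp
  moreover have "det (unitary_diag n U d) = det U * det D * det (mat_adjoint U)"
    unfolding unitary_diag_def D_def[symmetric] using u D by (simp add: det_mult[of _ n])
  moreover have "det D = (\<Prod>i<n. complex_of_real (d i))"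
    by (subst det_upper_triangular[OF _ D])
      (auto simp: D_def mat_diag_def diag_mat_def prod.list_conv_set_nth atLeast0LessThan)
  ultimately show ?thesis by (simp add: mult_ac)
qed

text \<open>Determinants of positive definite matrices as real numbers, so that \<open>powr\<close> and \<open>ln\<close> apply.\<close>

definition rdet :: "complex mat \<Rightarrow> real" where
  "rdet A = Re (det A)"

lemma pd_rdet:
  assumes "A \<in> pd_mats n"
  shows "det A = complex_of_real (rdet A)" and "rdet A = (\<Prod>i<n. eigvals_desc A ! i)"
    and "0 < rdet A" and "rdet (mat_powr A p) = rdet A powr p"
proof -
  define d where "d i = eigvals_desc A ! i" for i
  obtain U where U: "unitary_mat n U" and A: "A = unitary_diag n U d"
    and d: "\<And>i. i < n \<Longrightarrow> 0 < d i" using pd_spectral[OF assms] unfolding d_def by metis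
  have det: "rdet A = (\<Prod>i<n. d i)"
    unfolding rdet_def by (subst A) (simp only: det_unitary_diag[OF U] Re_complex_of_real)
  then show "rdet A = (\<Prod>i<n. eigvals_desc A ! i)" unfolding d_def .
  show "det A = complex_of_real (rdet A)"
    unfolding det by (subst A) (rule det_unitary_diag[OF U])
  show "0 < rdet A" unfolding det using d by (intro prod_pos) auto
  have "rdet (mat_powr A p) = (\<Prod>i<n. d i powr p)"
    unfolding rdet_def
    by (subst A) (simp only: mat_powr_unitary_diag[OF U] det_unitary_diag[OF U] Re_complex_of_real)
  also have "\<dots> = (\<Prod>i<n. d i) powr p"
    by (rule prod_powr_distrib[symmetric])
  finally show "rdet (mat_powr A p) = rdet A powr p" unfolding det .
qed

lemma rdet_sandwich:
  assumes "S \<in> pd_mats n" "X \<in> pd_mats n"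
  shows "rdet (S * X * S) = rdet S * rdet X * rdet S"
  using pd_matsD(1)[OF assms(1)] pd_matsD(1)[OF assms(2)] pd_rdet(1)[OF assms(1)] pd_rdet(1)[OF assms(2)]
  unfolding rdet_def[of "S * X * S"] by (simp add: det_mult[of _ n])

text \<open>Determinants are blind to the order of factors, and both means become the weighted
  geometric mean of the determinants of \<open>A\<close> and \<open>B\<close>; the computation is carried out with logarithms.\<close>

lemma rdet_F_mean_eq_Q_mean:
  assumes A: "A \<in> pd_mats n" and B: "B \<in> pd_mats n" and z: "0 < z"
  shows "rdet (F_mean t A B) = rdet (Q_mean t z A B)"
proof -
  have pos: "0 < rdet A" "0 < rdet B" using pd_rdet(3) A B by auto
  define G where "G = geom_mean t (mat_powr A (-1)) B"
  have G: "G \<in> pd_mats n" unfolding G_def by (rule geom_mean_inv_pd[OF A B])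
  define s where "s = (1 - t) / (2 * z)"
  have s: "z * s = (1 - t) / 2" unfolding s_def using z by simp
  have "rdet G = rdet A powr (-(1/2)) * (rdet A powr (1/2) * rdet B * rdet A powr (1/2)) powr t * rdet A powr (-(1/2))"
    unfolding G_def geom_mean_inv[OF A B]
    using A B by (simp add: rdet_sandwich[of _ n] pd_rdet(4)[of _ n] mat_powr_pd pd_sandwich)
  then have g: "ln (rdet G) = (t - 1) * ln (rdet A) + t * ln (rdet B)"
    using pos by (simp add: ln_mult ln_powr algebra_simps)
  have "rdet (F_mean t A B) = rdet G powr (1/2) * rdet A powr (2 - 2*t) * rdet G powr (1/2)"
    unfolding F_mean_def G_def[symmetric] using A G by (simp add: rdet_sandwich[of _ n] pd_rdet(4)[of _ n] mat_powr_pd)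
  then have f: "ln (rdet (F_mean t A B)) = (1 - t) * ln (rdet A) + t * ln (rdet B)"
    using pos pd_rdet(3)[OF G] by (simp add: ln_mult ln_powr g algebra_simps)
  have "rdet (Q_mean t z A B) = (rdet A powr s * rdet B powr (t/z) * rdet A powr s) powr z"
    unfolding Q_mean_def s_def[symmetric] using A B
    by (simp add: rdet_sandwich[of _ n] pd_rdet(4)[of _ n] mat_powr_pd pd_sandwich)
  then have "ln (rdet (Q_mean t z A B)) = 2 * (z * s) * ln (rdet A) + t * ln (rdet B)"
    using pos z by (simp add: ln_mult ln_powr algebra_simps)
  then have "ln (rdet (F_mean t A B)) = ln (rdet (Q_mean t z A B))" unfolding f s by simp
  then show ?thesis
    using pd_rdet(3)[OF F_mean_pd[OF A B]] pd_rdet(3)[OF Q_mean_pd[OF A B]] by simp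
qed

section \<open>Log-majorization\<close>

theorem theorem3p8:
  fixes m :: nat and A B :: "complex mat" and t z :: real
  assumes "A \<in> pd_mats m" and "B \<in> pd_mats m"
    and "0 < z" and "z \<le> t" and "t \<le> 1"
  shows "log_majorized m (F_mean t A B) (Q_mean t z A B)"
proof -
  note F = F_mean_pd[OF assms(1,2), of t] and Q = Q_mean_pd[OF assms(1,2), of t z]
  have "(\<Prod>i<m. eigvals_desc (F_mean t A B) ! i) = (\<Prod>i<m. eigvals_desc (Q_mean t z A B) ! i)"
    using rdet_F_mean_eq_Q_mean[OF assms(1-3), of t] unfolding pd_rdet(2)[OF F] pd_rdet(2)[OF Q] .
  then show ?thesis
    using F Q weak_log_majorization[OF assms] unfolding log_majorized_def by simp
qed

end
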